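(* Let $D=(0,1)$ and let $q,\chi_1,\chi_2$ be positive constants. There exist $\delta>0$ and $c>0$ such that every $\omega\in(0,\delta)$ is an eigenvalue of the problem $$ \begin{cases} E_1''+\omega^2 q E_1=-\omega^2\chi_1 E_2\overline{E}_1 & \text{in } D,\\ E_2''+4\omega^2 q E_2=-\omega^2\chi_2 E_1^2 & \text{in } D,\\ E_2=E_2'=0 & \text{at } \partial D=\{0,1\}, \end{cases} $$ with a corresponding eigenfunction $(E_1,E_2)$ satisfying $$ \|(E_1,E_2)\|_{H^2(D)\times L^2(D)}\ \geq\ \frac{c}{\omega^2}. $$
   Context: The unknowns $E_1,E_2$ are complex-valued functions on $D=(0,1)$; the bar denotes complex conjugation. A number $\omega$ is called an eigenvalue of the problem if the problem admits a nontrivial solution $(E_1,E_2)\neq(0,0)$, which is then called a corresponding eigenfunction. No boundary conditions are imposed on $E_1$. $H^2(D)$ is the Sobolev space of order 2, and $H^2(D)\times L^2(D)$ carries a standard product norm (with $E_1$ measured in $H^2(D)$ and $E_2$ in $L^2(D)$). The constants $\delta,c$ may depend on $q,\chi_1,\chi_2$, but not on $\omega$. *)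

theory Defs
  imports "HOL-Analysis.Analysis"
begin

definition test_function_on :: "real set \<Rightarrow> (real \<Rightarrow> real) \<Rightarrow> bool" where
  "test_function_on D \<phi> \<longleftrightarrow>
     (\<forall>k x. (deriv ^^ k) \<phi> field_differentiable (at x)) \<and>
     compact (closure {x. \<phi> x \<noteq> 0}) \<and> closure {x. \<phi> x \<noteq> 0} \<subseteq> D"

definition locally_integrable_on :: "(real \<Rightarrow> complex) \<Rightarrow> real set \<Rightarrow> bool" where
  "locally_integrable_on u D \<longleftrightarrow>
     (\<forall>K. compact K \<and> K \<subseteq> D \<longrightarrow> set_integrable lebesgue K u)"

definition weak_derivative :: "real set \<Rightarrow> nat \<Rightarrow> (real \<Rightarrow> complex) \<Rightarrow> (real \<Rightarrow> complex) \<Rightarrow> bool" where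
  "weak_derivative D k u v \<longleftrightarrow>
     locally_integrable_on u D \<and> locally_integrable_on v D \<and>
     (\<forall>\<phi>. test_function_on D \<phi> \<longrightarrow>
        (LINT x:D|lebesgue. (deriv ^^ k) \<phi> x *\<^sub>R u x) =
        (-1) ^ k * (LINT x:D|lebesgue. \<phi> x *\<^sub>R v x))"

definition L2_space :: "real set \<Rightarrow> (real \<Rightarrow> complex) set" where
  "L2_space D = {u \<in> borel_measurable (lebesgue_on D).
     integrable (lebesgue_on D) (\<lambda>x. (cmod (u x))\<^sup>2)}"

definition L2_norm_on :: "real set \<Rightarrow> (real \<Rightarrow> complex) \<Rightarrow> real" where
  "L2_norm_on D u = sqrt (LINT x|lebesgue_on D. (cmod (u x))\<^sup>2)"

definition H2_space :: "real set \<Rightarrow> (real \<Rightarrow> complex) set" where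
  "H2_space D = {u \<in> L2_space D. \<forall>k\<in>{1, 2}. \<exists>v \<in> L2_space D. weak_derivative D k u v}"

text \<open>On an open set a weak derivative is determined up to a null set, so the choice of
  representative does not affect the norm below. Both norms are meaningful only for members
  of the corresponding spaces.\<close>

definition weak_deriv :: "real set \<Rightarrow> nat \<Rightarrow> (real \<Rightarrow> complex) \<Rightarrow> real \<Rightarrow> complex" where
  "weak_deriv D k u = (SOME v. weak_derivative D k u v)"

definition H2_norm_on :: "real set \<Rightarrow> (real \<Rightarrow> complex) \<Rightarrow> real" where
  "H2_norm_on D u =
     sqrt ((L2_norm_on D u)\<^sup>2 + (L2_norm_on D (weak_deriv D 1 u))\<^sup>2
           + (L2_norm_on D (weak_deriv D 2 u))\<^sup>2)"

definition H2_L2_norm_on :: "real set \<Rightarrow> (real \<Rightarrow> complex) \<Rightarrow> (real \<Rightarrow> complex) \<Rightarrow> real" where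
  "H2_L2_norm_on D u v = sqrt ((H2_norm_on D u)\<^sup>2 + (L2_norm_on D v)\<^sup>2)"

abbreviation D1 :: "(real \<Rightarrow> complex) \<Rightarrow> real \<Rightarrow> complex" where
  "D1 f \<equiv> (\<lambda>x. vector_derivative f (at x))"

definition twice_differentiable_in :: "(real \<Rightarrow> complex) \<Rightarrow> real set \<Rightarrow> bool" where
  "twice_differentiable_in f D \<longleftrightarrow>
     (\<forall>x\<in>D. f differentiable (at x) \<and> D1 f differentiable (at x))"

text \<open>The unknowns are functions on the open interval \<open>(0,1)\<close>; their values elsewhere are
  irrelevant, so the conditions at the end points are stated through one-sided limits. The
  equations hold pointwise; since the right-hand sides are continuous, solutions are of
  class \<open>C\<^sup>2\<close> on the interval.\<close>

definition solves_problem ::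
  "real \<Rightarrow> real \<Rightarrow> real \<Rightarrow> real \<Rightarrow> (real \<Rightarrow> complex) \<Rightarrow> (real \<Rightarrow> complex) \<Rightarrow> bool" where
  "solves_problem q \<chi>\<^sub>1 \<chi>\<^sub>2 \<omega> E\<^sub>1 E\<^sub>2 \<longleftrightarrow>
     twice_differentiable_in E\<^sub>1 {0<..<1} \<and> twice_differentiable_in E\<^sub>2 {0<..<1} \<and>
     (\<forall>x\<in>{0<..<1}. D1 (D1 E\<^sub>1) x + of_real (\<omega>\<^sup>2 * q) * E\<^sub>1 x
        = - of_real (\<omega>\<^sup>2 * \<chi>\<^sub>1) * E\<^sub>2 x * cnj (E\<^sub>1 x)) \<and>
     (\<forall>x\<in>{0<..<1}. D1 (D1 E\<^sub>2) x + of_real (4 * \<omega>\<^sup>2 * q) * E\<^sub>2 x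
        = - of_real (\<omega>\<^sup>2 * \<chi>\<^sub>2) * (E\<^sub>1 x)\<^sup>2) \<and>
     (E\<^sub>2 \<longlongrightarrow> 0) (at_right 0) \<and> (D1 E\<^sub>2 \<longlongrightarrow> 0) (at_right 0) \<and>
     (E\<^sub>2 \<longlongrightarrow> 0) (at_left 1) \<and> (D1 E\<^sub>2 \<longlongrightarrow> 0) (at_left 1)"

definition eigenfunction ::
  "real \<Rightarrow> real \<Rightarrow> real \<Rightarrow> real \<Rightarrow> (real \<Rightarrow> complex) \<Rightarrow> (real \<Rightarrow> complex) \<Rightarrow> bool" where
  "eigenfunction q \<chi>\<^sub>1 \<chi>\<^sub>2 \<omega> E\<^sub>1 E\<^sub>2 \<longleftrightarrow>
     solves_problem q \<chi>\<^sub>1 \<chi>\<^sub>2 \<omega> E\<^sub>1 E\<^sub>2 \<and> (\<exists>x\<in>{0<..<1}. (E\<^sub>1 x, E\<^sub>2 x) \<noteq> (0, 0))"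

definition eigenvalue :: "real \<Rightarrow> real \<Rightarrow> real \<Rightarrow> real \<Rightarrow> bool" where
  "eigenvalue q \<chi>\<^sub>1 \<chi>\<^sub>2 \<omega> \<longleftrightarrow> (\<exists>E\<^sub>1 E\<^sub>2. eigenfunction q \<chi>\<^sub>1 \<chi>\<^sub>2 \<omega> E\<^sub>1 E\<^sub>2)"

end

(* Rescaling E1 = a u(2x - 1), E2 = b v(2x - 1) with a, b of order 1/omega^2 turns the problem into
   u'' + eta u = - v cnj(u), v'' + 4 eta v = - u^2 on [-1,1] with eta = omega^2 q / 4, v and v' vanishing
   at both ends. This has a nontrivial solution already for eta = 0, and it persists for small eta.
   Under the symmetry u(-x) = cnj(u(x)), v(-x) = cnj(v(x)) the solutions are power series in ix with
   real coefficients, determined by four real parameters, and only the conditions v(1) = v'(1) = 0 (four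
   real equations) remain. Close to a numerical solution the map from the parameters to (v(1), v'(1)) is affine
   up to a quadratic error, which is controlled by majorising the series; its values at the five vertices
   of a small simplex of parameters are enclosed by integer fixed-point arithmetic. Brouwer's theorem
   then gives a zero, for every sufficiently small eta. *)
theory Submission
  imports Defs
begin

text \<open>For eta = 0, clamping v at both ends forces the integral of u^2 over [-1,1] to vanish,
  so a real u would be zero: a solution must be genuinely complex. The symmetry makes the conditions
  at -1 the conjugates of those at 1, so four real unknowns face four real equations. Convergence up
  to |x| = 1 needs a majorant W with r < 1, while the data at 0, about 4.84 and 4.68, must stay
  below W(0) = 6 r^2; r = 9/10 with 6 r^2 = 4.86 just fits. No derivative and no inverse Jacobian is
  computed: the vertices are chosen so that, in the affine coordinates they define, the boundary map
  is nearly h times the identity. Brouwer's theorem then asks for an error below h. The nonlinear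
  error is of order h^2 and the numerical error does not depend on h; with h = 3/2 * 10^-6 both fit
  together. The bounds on u near the centre are uniform in eta, so the growth 1/omega^2 comes from
  the scaling factor a alone.\<close>

section \<open>Majorants for power series solutions\<close>

text \<open>\<open>negbin r p n\<close> is the coefficient of \<open>y\<^sup>n\<close> in \<open>(1 - r y)\<^bsup>-p\<^esup>\<close>. The function
  \<open>W = 6 r\<^sup>2 (1 - r y)\<^bsup>-2\<^esup>\<close> solves \<open>W'' = W\<^sup>2\<close> and is the majorant used for all coefficient bounds.
  For \<open>X = (1 - r y)\<^bsup>-p\<^esup>\<close> one has \<open>X'' = p (p + 1) r\<^sup>2 (1 - r y)\<^bsup>-p-2\<^esup>\<close> and
  \<open>2 W X = 12 r\<^sup>2 (1 - r y)\<^bsup>-p-2\<^esup>\<close>, so \<open>X\<close> dominates solutions of the linearised equation as soon as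
  \<open>p (p + 1) \<ge> 12\<close>, with room for an inhomogeneity if \<open>p = 4\<close>.\<close>

definition negbin :: "real \<Rightarrow> real \<Rightarrow> nat \<Rightarrow> real" where
  "negbin r p n = pochhammer p n / fact n * r ^ n"

definition conv :: "(nat \<Rightarrow> real) \<Rightarrow> (nat \<Rightarrow> real) \<Rightarrow> nat \<Rightarrow> real" where
  "conv a b n = (\<Sum>k\<le>n. a k * b (n - k))"

definition alt :: "(nat \<Rightarrow> real) \<Rightarrow> nat \<Rightarrow> real" where
  "alt a n = (-1) ^ n * a n"

lemma negbin_0 [simp]: "negbin r p 0 = 1" by (simp add: negbin_def)

lemma negbin_1: "negbin r p (Suc 0) = p * r" by (simp add: negbin_def)

lemma negbin_nonneg: "r \<ge> 0 \<Longrightarrow> p \<ge> 0 \<Longrightarrow> negbin r p n \<ge> 0"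
  by (simp add: negbin_def pochhammer_prod prod_nonneg)

lemma negbin_mono:
  assumes "r \<ge> 0" "0 \<le> p" "p \<le> q"
  shows "negbin r p n \<le> negbin r q n"
proof -
  have "pochhammer p n \<le> pochhammer q n"
    unfolding pochhammer_prod using assms by (intro prod_mono) auto
  thus ?thesis using assms by (simp add: negbin_def divide_right_mono mult_right_mono)
qed

text \<open>Coefficient form of the derivative p r (1 - r y)^-(p+1) of (1 - r y)^-p.\<close>

lemma negbin_Suc: "(real n + 1) * negbin r p (Suc n) = p * r * negbin r (p + 1) n"
proof -
  have "pochhammer p (Suc n) / fact (Suc n) * (real n + 1) = p * pochhammer (p + 1) n / fact n"
    by (simp add: pochhammer_rec divide_simps del: of_nat_Suc)
  hence "(pochhammer p (Suc n) / fact (Suc n) * (real n + 1)) * r ^ Suc n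
      = (p * pochhammer (p + 1) n / fact n) * r ^ Suc n"
    by (rule arg_cong)
  thus ?thesis by (simp add: negbin_def mult_ac del: fact_Suc)
qed

lemma negbin_Suc_Suc:
  "(real n + 1) * (real n + 2) * negbin r p (n + 2) = p * (p + 1) * r\<^sup>2 * negbin r (p + 2) n"
proof -
  have 1: "(real n + 2) * negbin r p (n + 2) = p * r * negbin r (p + 1) (Suc n)"
    using negbin_Suc[of "Suc n" r p] by (simp add: add_ac)
  have 2: "(real n + 1) * negbin r (p + 1) (Suc n) = (p + 1) * r * negbin r (p + 2) n"
    using negbin_Suc[of n r "p + 1"] by (simp add: add.assoc)
  have "(real n + 1) * (real n + 2) * negbin r p (n + 2)
     = p * r * ((real n + 1) * negbin r (p + 1) (Suc n))"
    unfolding mult.assoc 1 by (simp only: mult_ac)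
  thus ?thesis unfolding 2 by (simp only: mult_ac power2_eq_square)
qed

text \<open>Coefficient form of (1 - r y)^-p (1 - r y)^-q = (1 - r y)^-(p+q); this is the
  Vandermonde identity for rising factorials.\<close>

lemma conv_negbin: "conv (negbin r p) (negbin r q) n = negbin r (p + q) n"
proof -
  have "conv (negbin r p) (negbin r q) n
      = (\<Sum>k\<le>n. of_nat (n choose k) * pochhammer p k * pochhammer q (n - k)) / fact n * r ^ n"
    unfolding conv_def sum_divide_distrib sum_distrib_right
  proof (intro sum.cong refl)
    fix k assume "k \<in> {..n}"
    hence k: "k \<le> n" by simp
    hence "r ^ n = r ^ k * r ^ (n - k)" by (simp flip: power_add)
    thus "negbin r p k * negbin r q (n - k)
        = of_nat (n choose k) * pochhammer p k * pochhammer q (n - k) / fact n * r ^ n"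
      by (simp add: negbin_def binomial_fact[OF k])
  qed
  thus ?thesis by (simp add: negbin_def pochhammer_binomial_sum)
qed

lemma sums_negbin:
  assumes "0 \<le> r" "r < 1"
  shows "negbin r p sums ((1 - r) powr - p)"
proof -
  have "(\<lambda>n. (- p gchoose n) * (- r) ^ n) sums (1 + - r) powr - p"
    using assms by (intro gen_binomial_real) auto
  moreover have "(- p gchoose n) * (- r) ^ n = negbin r p n" for n
  proof -
    have "(-1) ^ n * (- r) ^ n = r ^ n" by (simp flip: power_mult_distrib)
    thus ?thesis by (simp add: negbin_def gbinomial_pochhammer mult_ac)
  qed
  ultimately show ?thesis by simp
qed

lemma sums_nat_negbin:
  assumes "0 \<le> r" "r < 1"
  shows "(\<lambda>n. real n * negbin r p n) sums (p * r * (1 - r) powr - (p + 1))"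
proof -
  have "(\<lambda>n. real (Suc n) * negbin r p (Suc n)) = (\<lambda>n. p * r * negbin r (p + 1) n)"
    using negbin_Suc[of _ r p] by (auto simp: add_ac)
  moreover have "(\<lambda>n. p * r * negbin r (p + 1) n) sums (p * r * (1 - r) powr - (p + 1))"
    by (intro sums_mult sums_negbin assms)
  ultimately show ?thesis
    using sums_Suc[of "\<lambda>n. real n * negbin r p n"] by simp
qed

lemma abs_conv_le:
  assumes "\<And>k. k \<le> n \<Longrightarrow> \<bar>a k\<bar> \<le> A * negbin r p k"
    and "\<And>k. k \<le> n \<Longrightarrow> \<bar>b k\<bar> \<le> B * negbin r q k"
  shows "\<bar>conv a b n\<bar> \<le> A * B * negbin r (p + q) n"
proof -
  have "\<bar>conv a b n\<bar> \<le> (\<Sum>k\<le>n. \<bar>a k\<bar> * \<bar>b (n - k)\<bar>)"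
    unfolding conv_def using sum_abs[of "\<lambda>k. a k * b (n - k)"] by (simp add: abs_mult)
  also have "\<dots> \<le> (\<Sum>k\<le>n. (A * negbin r p k) * (B * negbin r q (n - k)))"
    by (intro sum_mono mult_mono assms)
       (auto intro: order_trans[OF abs_ge_zero assms(1)])
  also have "\<dots> = A * B * conv (negbin r p) (negbin r q) n"
    by (simp add: conv_def sum_distrib_left mult_ac)
  finally show ?thesis by (simp add: conv_negbin)
qed

lemma conv_diff: "conv a b n - conv a' b' n
  = conv (\<lambda>k. a k - a' k) b n + conv a' (\<lambda>k. b k - b' k) n"
  unfolding conv_def sum_subtractf[symmetric] sum.distrib[symmetric]
  by (intro sum.cong refl) (simp add: algebra_simps)

text \<open>Splits the failure of a product to be affine. The first two terms are linear in the
  failures of the factors and belong to the linearised equation; the last one contains only products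
  of two first differences and is the sole source of the quadratic error.\<close>

lemma conv_second_order:
  "conv a b n - conv a0 b0 n - (\<Sum>j\<in>J. s j * (conv (a' j) (b' j) n - conv a0 b0 n))
   = conv (\<lambda>k. a k - a0 k - (\<Sum>j\<in>J. s j * (a' j k - a0 k))) b n
     + conv a0 (\<lambda>k. b k - b0 k - (\<Sum>j\<in>J. s j * (b' j k - b0 k))) n
     + (\<Sum>j\<in>J. s j * conv (\<lambda>k. a' j k - a0 k) (\<lambda>k. b k - b' j k) n)"
proof -
  have *: "x * y - x0 * y0 - (\<Sum>j\<in>J. s j * (x' j * y' j - x0 * y0))
     = (x - x0 - (\<Sum>j\<in>J. s j * (x' j - x0))) * y
       + x0 * (y - y0 - (\<Sum>j\<in>J. s j * (y' j - y0)))
       + (\<Sum>j\<in>J. s j * ((x' j - x0) * (y - y' j)))"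
    for x y x0 y0 :: real and x' y'
  proof -
    have "(\<Sum>j\<in>J. s j * (x' j * y' j - x0 * y0)) = (\<Sum>j\<in>J. s j * (x' j - x0)) * y
       + x0 * (\<Sum>j\<in>J. s j * (y' j - y0)) - (\<Sum>j\<in>J. s j * ((x' j - x0) * (y - y' j)))"
      unfolding sum_distrib_left sum_distrib_right sum.distrib[symmetric] sum_subtractf[symmetric]
      by (intro sum.cong refl) (simp add: algebra_simps)
    thus ?thesis by (simp add: algebra_simps)
  qed
  have sw: "(\<Sum>j\<in>J. s j * (\<Sum>k\<le>n. f j k)) = (\<Sum>k\<le>n. \<Sum>j\<in>J. s j * f j k)" for f
    unfolding sum_distrib_left by (rule sum.swap)
  show ?thesis
    unfolding conv_def sum_subtractf[symmetric] sw sum.distrib[symmetric]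
    by (intro sum.cong refl *)
qed

text \<open>With \<open>u(x) = \<Sum>U\<^sub>n (\<i>x)\<^sup>n\<close> and \<open>v(x) = \<Sum>V\<^sub>n (\<i>x)\<^sup>n\<close> this encodes \<open>u'' + \<eta> u = - v cnj(u)\<close> and
  \<open>v'' + 4 \<eta> v = - u\<^sup>2\<close>; the coefficients are real exactly if \<open>u(-x) = cnj(u(x))\<close> and
  \<open>v(-x) = cnj(v(x))\<close>, whence the alternating signs.\<close>

definition power_solution :: "real \<Rightarrow> (nat \<Rightarrow> real) \<Rightarrow> (nat \<Rightarrow> real) \<Rightarrow> bool" where
  "power_solution \<eta> U V \<longleftrightarrow> (\<forall>n.
     (real n + 1) * (real n + 2) * U (n + 2) = \<eta> * U n + conv V (alt U) n \<and>
     (real n + 1) * (real n + 2) * V (n + 2) = 4 * \<eta> * V n + conv U U n)"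

lemma power_solutionD:
  assumes "power_solution \<eta> U V"
  shows "(real n + 1) * (real n + 2) * U (n + 2) = \<eta> * U n + conv V (alt U) n"
    and "(real n + 1) * (real n + 2) * V (n + 2) = 4 * \<eta> * V n + conv U U n"
  using assms unfolding power_solution_def by blast+

lemma abs_alt [simp]: "\<bar>alt a n\<bar> = \<bar>a n\<bar>"
  by (simp add: alt_def abs_mult power_abs)

lemma alt_diff: "alt (\<lambda>k. a k - b k) = (\<lambda>k. alt a k - alt b k)"
  by (simp add: alt_def fun_eq_iff algebra_simps)

lemma abs_alt_diff [simp]: "\<bar>alt a n - alt b n\<bar> = \<bar>a n - b n\<bar>"
  using abs_alt[of "\<lambda>k. a k - b k"] by (simp add: alt_diff)

section \<open>Bounds for single solutions and for differences of solutions\<close>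

lemma scaled_le_imp_le:
  "(real m + 1) * (real m + 2) * a \<le> (real m + 1) * (real m + 2) * b \<Longrightarrow> a \<le> b"
  by (simp add: mult_le_cancel_left_pos)

lemma abs_scaled: "\<bar>(real m + 1) * (real m + 2) * a\<bar> = (real m + 1) * (real m + 2) * \<bar>a\<bar>"
  by (simp add: abs_mult)

text \<open>By \<open>negbin_Suc_Suc\<close> the bound required in \<open>step\<close> is (m + 1) (m
  + 2) times the claimed bound at index m + 2, so the recursion propagates it. The cap
  \<open>N\<close> allows for sequences that are controlled only up to a finite index, such as the
  rounded coefficients.\<close>

lemma negbin_majorant:
  fixes N :: nat
  assumes step: "\<And>m. m + 2 \<le> N \<Longrightarrow>
      (\<And>k. k \<le> m \<Longrightarrow> \<bar>x k\<bar> \<le> \<kappa> * negbin r p k \<and> \<bar>y k\<bar> \<le> \<kappa> * negbin r p k) \<Longrightarrow>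
      \<bar>(real m + 1) * (real m + 2) * x (m + 2)\<bar> \<le> \<kappa> * (p * (p + 1)) * r\<^sup>2 * negbin r (p + 2) m \<and>
      \<bar>(real m + 1) * (real m + 2) * y (m + 2)\<bar> \<le> \<kappa> * (p * (p + 1)) * r\<^sup>2 * negbin r (p + 2) m"
    and init: "\<bar>x 0\<bar> \<le> \<kappa>" "\<bar>y 0\<bar> \<le> \<kappa>" "\<bar>x 1\<bar> \<le> \<kappa> * p * r" "\<bar>y 1\<bar> \<le> \<kappa> * p * r"
    and "n \<le> N"
  shows "\<bar>x n\<bar> \<le> \<kappa> * negbin r p n \<and> \<bar>y n\<bar> \<le> \<kappa> * negbin r p n"
  using \<open>n \<le> N\<close>
proof (induction n rule: less_induct)
  case (less n)
  consider "n = 0" | "n = 1" | m where "n = m + 2"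
    by (metis One_nat_def add_2_eq_Suc' not0_implies_Suc)
  thus ?case
  proof cases
    case 3
    have "(real m + 1) * (real m + 2) * (\<kappa> * negbin r p (m + 2))
        = \<kappa> * ((real m + 1) * (real m + 2) * negbin r p (m + 2))"
      by (simp only: mult_ac)
    hence "(real m + 1) * (real m + 2) * (\<kappa> * negbin r p (m + 2))
        = \<kappa> * (p * (p + 1)) * r\<^sup>2 * negbin r (p + 2) m"
      unfolding negbin_Suc_Suc by (simp only: mult_ac)
    moreover have
      "\<bar>(real m + 1) * (real m + 2) * x (m + 2)\<bar> \<le> \<kappa> * (p * (p + 1)) * r\<^sup>2 * negbin r (p + 2) m \<and>
       \<bar>(real m + 1) * (real m + 2) * y (m + 2)\<bar> \<le> \<kappa> * (p * (p + 1)) * r\<^sup>2 * negbin r (p + 2) m"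
      using less 3 by (intro step) auto
    ultimately have
      "(real m + 1) * (real m + 2) * \<bar>x (m + 2)\<bar> \<le> (real m + 1) * (real m + 2) * (\<kappa> * negbin r p (m + 2))"
      "(real m + 1) * (real m + 2) * \<bar>y (m + 2)\<bar> \<le> (real m + 1) * (real m + 2) * (\<kappa> * negbin r p (m + 2))"
      unfolding abs_scaled by linarith+
    thus ?thesis unfolding 3 by (blast dest: scaled_le_imp_le)
  qed (use init in \<open>auto simp: negbin_1 mult_ac\<close>)
qed

text \<open>The convolutions cost M^2 = 36 mu^2 r^4 out of the available 36 mu r^4, where M = 6 mu
  r^2. Shrinking the majorant by mu thus leaves the fraction 1 - mu for the linear terms with
  eta.\<close>

lemma power_solution_bound:
  assumes r: "r > 0" and \<eta>: "0 \<le> \<eta>" "4 * \<eta> \<le> \<mu> * (1 - \<mu>)" "2 * r\<^sup>2 \<ge> \<mu>"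
    and sol: "power_solution \<eta> U V"
    and init: "\<bar>U 0\<bar> \<le> 6 * \<mu> * r\<^sup>2" "\<bar>V 0\<bar> \<le> 6 * \<mu> * r\<^sup>2"
      "\<bar>U 1\<bar> \<le> 12 * \<mu> * r ^ 3" "\<bar>V 1\<bar> \<le> 12 * \<mu> * r ^ 3"
    and \<mu>: "0 < \<mu>" "\<mu> \<le> 1"
  shows "\<bar>U n\<bar> \<le> 6 * \<mu> * r\<^sup>2 * negbin r 2 n \<and> \<bar>V n\<bar> \<le> 6 * \<mu> * r\<^sup>2 * negbin r 2 n"
proof -
  let ?M = "6 * \<mu> * r\<^sup>2"
  show ?thesis
  proof (rule negbin_majorant[where N = n and p = 2])
    fix m
    assume b': "\<And>k. k \<le> m \<Longrightarrow> \<bar>U k\<bar> \<le> ?M * negbin r 2 k \<and> \<bar>V k\<bar> \<le> ?M * negbin r 2 k"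
    have b: "\<bar>U k\<bar> \<le> ?M * negbin r 2 k" "\<bar>V k\<bar> \<le> ?M * negbin r 2 k" if "k \<le> m" for k
      using b'[of k] that by auto
    have c: "\<bar>conv V (alt U) m\<bar> \<le> ?M * ?M * negbin r 4 m" "\<bar>conv U U m\<bar> \<le> ?M * ?M * negbin r 4 m"
      using abs_conv_le[of m V ?M r 2 "alt U" ?M 2] abs_conv_le[of m U ?M r 2 U ?M 2] b by auto
    have N: "negbin r 2 m \<le> negbin r 4 m" "0 \<le> negbin r 4 m"
      using r by (auto intro: negbin_mono negbin_nonneg)
    have lin: "\<bar>\<epsilon> * f\<bar> \<le> \<mu> * (1 - \<mu>) * ?M * negbin r 4 m"
      if "0 \<le> \<epsilon>" "\<epsilon> \<le> 4 * \<eta>" "\<bar>f\<bar> \<le> ?M * negbin r 2 m" for \<epsilon> f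
    proof -
      have "\<bar>\<epsilon> * f\<bar> \<le> (\<mu> * (1 - \<mu>)) * (?M * negbin r 4 m)"
        unfolding abs_mult using that \<eta> N r \<mu>
        by (intro mult_mono) (auto intro: order_trans[OF _ mult_left_mono[OF N(1)]])
      thus ?thesis by simp
    qed
    have "\<mu> * (1 - \<mu>) * ?M + ?M * ?M \<le> 36 * \<mu> * r ^ 4"
    proof -
      have "\<mu> * (1 - \<mu>) \<le> 6 * (1 - \<mu>) * r\<^sup>2"
        using mult_right_mono[OF \<eta>(3), of "1 - \<mu>"] \<mu> mult_nonneg_nonneg[of "1 - \<mu>" "r\<^sup>2"]
        by (simp add: algebra_simps)
      hence "\<mu> * (1 - \<mu>) * ?M \<le> 6 * (1 - \<mu>) * r\<^sup>2 * ?M"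
        using \<mu> by (intro mult_right_mono) auto
      thus ?thesis by (simp add: algebra_simps power2_eq_square power4_eq_xxxx)
    qed
    hence fin: "(\<mu> * (1 - \<mu>) * ?M + ?M * ?M) * negbin r 4 m \<le> 36 * \<mu> * r ^ 4 * negbin r 4 m"
      using N by (intro mult_right_mono)
    have "36 * \<mu> * r ^ 4 * negbin r 4 m = ?M * (2 * (2 + 1)) * r\<^sup>2 * negbin r (2 + 2) m"
      by (simp add: power2_eq_square power4_eq_xxxx)
    moreover have "\<bar>(real m + 1) * (real m + 2) * U (m + 2)\<bar> \<le> (\<mu> * (1 - \<mu>) * ?M + ?M * ?M) * negbin r 4 m"
      unfolding power_solutionD(1)[OF sol] using lin[of \<eta> "U m"] c(1) b(1)[OF order_refl] \<eta>(1)
        distrib_right[of "\<mu> * (1 - \<mu>) * ?M" "?M * ?M" "negbin r 4 m"] by linarith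
    moreover have "\<bar>(real m + 1) * (real m + 2) * V (m + 2)\<bar> \<le> (\<mu> * (1 - \<mu>) * ?M + ?M * ?M) * negbin r 4 m"
      unfolding power_solutionD(2)[OF sol] using lin[of "4 * \<eta>" "V m"] c(2) b(2)[OF order_refl] \<eta>(1)
        distrib_right[of "\<mu> * (1 - \<mu>) * ?M" "?M * ?M" "negbin r 4 m"] by linarith
    ultimately show
      "\<bar>(real m + 1) * (real m + 2) * U (m + 2)\<bar> \<le> ?M * (2 * (2 + 1)) * r\<^sup>2 * negbin r (2 + 2) m \<and>
       \<bar>(real m + 1) * (real m + 2) * V (m + 2)\<bar> \<le> ?M * (2 * (2 + 1)) * r\<^sup>2 * negbin r (2 + 2) m"
      using fin by linarith
  qed (use init in \<open>auto simp: power3_eq_cube power2_eq_square mult_ac\<close>)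
qed

text \<open>The change of a product consists of two terms, each with one factor bounded by W; this
  uses 2 * 6 r^2 = 12 r^2 of the available p (p + 1) r^2. The rest, p (p + 1) - 12, pays for a
  defect in the equation: nothing for p = 3, which suffices for exact solutions with eta = 0, and 8
  for p = 4, which covers rounding errors and the terms with eta.\<close>

lemma difference_bound:
  fixes N :: nat
  assumes r: "r > 0" and p: "p \<ge> 0"  and \<kappa>: "\<kappa> \<ge> 0"
    and bd: "\<And>n. n \<le> N \<Longrightarrow> \<bar>U n\<bar> \<le> 6 * r\<^sup>2 * negbin r 2 n" "\<And>n. n \<le> N \<Longrightarrow> \<bar>V n\<bar> \<le> 6 * r\<^sup>2 * negbin r 2 n"
      "\<And>n. n \<le> N \<Longrightarrow> \<bar>U' n\<bar> \<le> 6 * r\<^sup>2 * negbin r 2 n" "\<And>n. n \<le> N \<Longrightarrow> \<bar>V' n\<bar> \<le> 6 * r\<^sup>2 * negbin r 2 n"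
    and defU: "\<And>n. n + 2 \<le> N \<Longrightarrow> \<bar>(real n + 1) * (real n + 2) * (U (n + 2) - U' (n + 2))
        - (conv V (alt U) n - conv V' (alt U') n)\<bar> \<le> \<kappa> * (p * (p + 1) - 12) * r\<^sup>2 * negbin r (p + 2) n"
    and defV: "\<And>n. n + 2 \<le> N \<Longrightarrow> \<bar>(real n + 1) * (real n + 2) * (V (n + 2) - V' (n + 2))
        - (conv U U n - conv U' U' n)\<bar> \<le> \<kappa> * (p * (p + 1) - 12) * r\<^sup>2 * negbin r (p + 2) n"
    and init: "\<bar>U 0 - U' 0\<bar> \<le> \<kappa>" "\<bar>V 0 - V' 0\<bar> \<le> \<kappa>"
      "\<bar>U 1 - U' 1\<bar> \<le> \<kappa> * p * r" "\<bar>V 1 - V' 1\<bar> \<le> \<kappa> * p * r"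
    and "n \<le> N"
  shows "\<bar>U n - U' n\<bar> \<le> \<kappa> * negbin r p n \<and> \<bar>V n - V' n\<bar> \<le> \<kappa> * negbin r p n"
proof (rule negbin_majorant[where N = N])
  fix m
  let ?W = "6 * r\<^sup>2"
  assume m: "m + 2 \<le> N" and d': "\<And>k. k \<le> m \<Longrightarrow>
    \<bar>U k - U' k\<bar> \<le> \<kappa> * negbin r p k \<and> \<bar>V k - V' k\<bar> \<le> \<kappa> * negbin r p k"
  have d: "\<bar>U k - U' k\<bar> \<le> \<kappa> * negbin r p k" "\<bar>V k - V' k\<bar> \<le> \<kappa> * negbin r p k" if "k \<le> m" for k
    using d'[of k] that by auto
    have cd: "\<bar>conv a b m - conv a' b' m\<bar> \<le> 12 * r\<^sup>2 * \<kappa> * negbin r (p + 2) m"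
      if "\<And>k. k \<le> m \<Longrightarrow> \<bar>a' k\<bar> \<le> ?W * negbin r 2 k" "\<And>k. k \<le> m \<Longrightarrow> \<bar>b k\<bar> \<le> ?W * negbin r 2 k"
        "\<And>k. k \<le> m \<Longrightarrow> \<bar>a k - a' k\<bar> \<le> \<kappa> * negbin r p k" "\<And>k. k \<le> m \<Longrightarrow> \<bar>b k - b' k\<bar> \<le> \<kappa> * negbin r p k"
      for a a' b b'
      using abs_conv_le[of m "\<lambda>k. a k - a' k" \<kappa> r p b ?W 2]
        abs_conv_le[of m a' ?W r 2 "\<lambda>k. b k - b' k" \<kappa> p] that
      unfolding conv_diff[of a b m a' b'] by (simp add: add_ac mult_ac)
have "\<bar>conv V (alt U) m - conv V' (alt U') m\<bar> \<le> 12 * r\<^sup>2 * \<kappa> * negbin r (p + 2) m"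
      "\<bar>conv U U m - conv U' U' m\<bar> \<le> 12 * r\<^sup>2 * \<kappa> * negbin r (p + 2) m"
      using m d by (auto intro!: cd bd)
    moreover have "\<kappa> * (p * (p + 1)) * r\<^sup>2 * negbin r (p + 2) m
        = \<kappa> * (p * (p + 1) - 12) * r\<^sup>2 * negbin r (p + 2) m + 12 * r\<^sup>2 * \<kappa> * negbin r (p + 2) m"
      by (simp add: algebra_simps)
    ultimately show
      "\<bar>(real m + 1) * (real m + 2) * (U (m + 2) - U' (m + 2))\<bar> \<le> \<kappa> * (p * (p + 1)) * r\<^sup>2 * negbin r (p + 2) m \<and>
       \<bar>(real m + 1) * (real m + 2) * (V (m + 2) - V' (m + 2))\<bar> \<le> \<kappa> * (p * (p + 1)) * r\<^sup>2 * negbin r (p + 2) m"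
      using defU[OF m] defV[OF m] by linarith
qed (use init \<open>n \<le> N\<close> in auto)

text \<open>The deviation from affine dependence solves the linearised equation with an
  inhomogeneity made of products of first differences. Two differences with exponent 3 give the
  exponent 6 = 4 + 2, just what the majorant with p = 4 absorbs.\<close>

lemma second_order_bound:
  assumes r: "r > 0" and e: "e \<ge> 0"
    and sol: "power_solution 0 U V" "power_solution 0 U0 V0" "\<And>j. j \<in> J \<Longrightarrow> power_solution 0 (Uj j) (Vj j)"
    and bd: "\<And>n. \<bar>U n\<bar> \<le> 6 * r\<^sup>2 * negbin r 2 n" "\<And>n. \<bar>U0 n\<bar> \<le> 6 * r\<^sup>2 * negbin r 2 n"
      "\<And>n. \<bar>V0 n\<bar> \<le> 6 * r\<^sup>2 * negbin r 2 n"
    and da: "\<And>j n. j \<in> J \<Longrightarrow> \<bar>Uj j n - U0 n\<bar> \<le> a * negbin r 3 n"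
      "\<And>j n. j \<in> J \<Longrightarrow> \<bar>Vj j n - V0 n\<bar> \<le> a * negbin r 3 n"
    and db: "\<And>j n. j \<in> J \<Longrightarrow> \<bar>U n - Uj j n\<bar> \<le> b * negbin r 3 n"
    and s: "(\<Sum>j\<in>J. \<bar>s j\<bar>) * (a * b) \<le> 8 * r\<^sup>2 * e"
    and init: "\<And>n. n \<le> 1 \<Longrightarrow> U n - U0 n = (\<Sum>j\<in>J. s j * (Uj j n - U0 n))"
      "\<And>n. n \<le> 1 \<Longrightarrow> V n - V0 n = (\<Sum>j\<in>J. s j * (Vj j n - V0 n))"
  shows "\<bar>U n - U0 n - (\<Sum>j\<in>J. s j * (Uj j n - U0 n))\<bar> \<le> e * negbin r 4 n \<and>
    \<bar>V n - V0 n - (\<Sum>j\<in>J. s j * (Vj j n - V0 n))\<bar> \<le> e * negbin r 4 n"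
proof (rule negbin_majorant[where N = n])
  fix m
  let ?W = "6 * r\<^sup>2"
  let ?x = "\<lambda>n. U n - U0 n - (\<Sum>j\<in>J. s j * (Uj j n - U0 n))"
  let ?y = "\<lambda>n. V n - V0 n - (\<Sum>j\<in>J. s j * (Vj j n - V0 n))"
  assume d': "\<And>k. k \<le> m \<Longrightarrow> \<bar>?x k\<bar> \<le> e * negbin r 4 k \<and> \<bar>?y k\<bar> \<le> e * negbin r 4 k"
  have d: "\<bar>?x k\<bar> \<le> e * negbin r 4 k" "\<bar>?y k\<bar> \<le> e * negbin r 4 k" if "k \<le> m" for k
    using d'[of k] that by auto
  let ?B = "e * (4 * (4 + 1)) * r\<^sup>2 * negbin r (4 + 2) m"
  have main: "\<bar>conv f g m - conv f0 g0 m - (\<Sum>j\<in>J. s j * (conv (fj j) (gj j) m - conv f0 g0 m))\<bar> \<le> ?B"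
    if "\<And>k. k \<le> m \<Longrightarrow> \<bar>g k\<bar> \<le> ?W * negbin r 2 k" "\<And>k. k \<le> m \<Longrightarrow> \<bar>f0 k\<bar> \<le> ?W * negbin r 2 k"
      "\<And>k. k \<le> m \<Longrightarrow> \<bar>f k - f0 k - (\<Sum>j\<in>J. s j * (fj j k - f0 k))\<bar> \<le> e * negbin r 4 k"
      "\<And>k. k \<le> m \<Longrightarrow> \<bar>g k - g0 k - (\<Sum>j\<in>J. s j * (gj j k - g0 k))\<bar> \<le> e * negbin r 4 k"
      "\<And>j k. j \<in> J \<Longrightarrow> \<bar>fj j k - f0 k\<bar> \<le> a * negbin r 3 k"
      "\<And>j k. j \<in> J \<Longrightarrow> \<bar>g k - gj j k\<bar> \<le> b * negbin r 3 k"
    for f g f0 g0 fj gj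
  proof -
    have "\<bar>conv (\<lambda>k. f k - f0 k - (\<Sum>j\<in>J. s j * (fj j k - f0 k))) g m\<bar> \<le> e * ?W * negbin r 6 m"
      using abs_conv_le[of m _ e r 4 g ?W 2] that by simp
    moreover have "\<bar>conv f0 (\<lambda>k. g k - g0 k - (\<Sum>j\<in>J. s j * (gj j k - g0 k))) m\<bar> \<le> ?W * e * negbin r 6 m"
      using abs_conv_le[of m f0 ?W r 2 _ e 4] that by simp
    moreover have "\<bar>\<Sum>j\<in>J. s j * conv (\<lambda>k. fj j k - f0 k) (\<lambda>k. g k - gj j k) m\<bar> \<le> 8 * r\<^sup>2 * e * negbin r 6 m"
    proof -
      have "\<bar>\<Sum>j\<in>J. s j * conv (\<lambda>k. fj j k - f0 k) (\<lambda>k. g k - gj j k) m\<bar>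
          \<le> (\<Sum>j\<in>J. \<bar>s j\<bar> * (a * b * negbin r 6 m))"
      proof (rule order_trans[OF sum_abs sum_mono])
        fix j assume "j \<in> J"
        hence "\<bar>conv (\<lambda>k. fj j k - f0 k) (\<lambda>k. g k - gj j k) m\<bar> \<le> a * b * negbin r 6 m"
          using abs_conv_le[of m "\<lambda>k. fj j k - f0 k" a r 3 "\<lambda>k. g k - gj j k" b 3] that by simp
        thus "\<bar>s j * conv (\<lambda>k. fj j k - f0 k) (\<lambda>k. g k - gj j k) m\<bar> \<le> \<bar>s j\<bar> * (a * b * negbin r 6 m)"
          unfolding abs_mult by (intro mult_left_mono) auto
      qed
      also have "\<dots> = (\<Sum>j\<in>J. \<bar>s j\<bar>) * (a * b) * negbin r 6 m"
        by (simp only: sum_distrib_right mult.assoc)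
      also have "\<dots> \<le> 8 * r\<^sup>2 * e * negbin r 6 m"
        using r by (intro mult_right_mono s negbin_nonneg) auto
      finally show ?thesis .
    qed
    \<comment> \<open>6 + 6 + 8 = 20 = 4 * 5: the linearised terms leave 8 for the quadratic one,
      whence the 8 in the hypothesis on a * b.\<close>
    moreover have "e * ?W * negbin r 6 m + ?W * e * negbin r 6 m + 8 * r\<^sup>2 * e * negbin r 6 m = ?B"
      by simp
    ultimately show ?thesis unfolding conv_second_order by linarith
  qed
  have sc: "c * (A - A0 - (\<Sum>j\<in>J. s j * (Aj j - A0))) = c * A - c * A0 - (\<Sum>j\<in>J. s j * (c * Aj j - c * A0))"
    for c A A0 :: real and Aj
    by (simp add: algebra_simps sum_distrib_left sum_subtractf)
  have altx: "alt U k - alt U0 k - (\<Sum>j\<in>J. s j * (alt (Uj j) k - alt U0 k)) = alt ?x k" for k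
    unfolding alt_def sc ..
  have rec: "(real m + 1) * (real m + 2) * ?x (m + 2)
      = conv V (alt U) m - conv V0 (alt U0) m - (\<Sum>j\<in>J. s j * (conv (Vj j) (alt (Uj j)) m - conv V0 (alt U0) m))"
    "(real m + 1) * (real m + 2) * ?y (m + 2)
      = conv U U m - conv U0 U0 m - (\<Sum>j\<in>J. s j * (conv (Uj j) (Uj j) m - conv U0 U0 m))"
    unfolding sc by (simp_all add: power_solutionD[OF sol(1)] power_solutionD[OF sol(2)]
        power_solutionD[OF sol(3)] del: add_2_eq_Suc' cong: sum.cong)
  show "\<bar>(real m + 1) * (real m + 2) * ?x (m + 2)\<bar> \<le> ?B \<and> \<bar>(real m + 1) * (real m + 2) * ?y (m + 2)\<bar> \<le> ?B"
    unfolding rec using d da db bd by (intro conjI main) (auto simp: altx)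
qed (use init e r in auto)

section \<open>Solutions from initial data, and their sums as analytic functions\<close>

fun coef :: "real \<Rightarrow> real \<times> real \<Rightarrow> real \<times> real \<Rightarrow> nat \<Rightarrow> real \<times> real" where
  "coef \<eta> a b 0 = a"
| "coef \<eta> a b (Suc 0) = b"
| "coef \<eta> a b (Suc (Suc n)) =
    ((\<eta> * fst (coef \<eta> a b n)
      + (\<Sum>k\<le>n. snd (coef \<eta> a b k) * ((-1) ^ (n - k) * fst (coef \<eta> a b (n - k))))) / ((real n + 1) * (real n + 2)),
     (4 * \<eta> * snd (coef \<eta> a b n)
      + (\<Sum>k\<le>n. fst (coef \<eta> a b k) * fst (coef \<eta> a b (n - k)))) / ((real n + 1) * (real n + 2)))"

lemma power_solution_coef: "power_solution \<eta> (\<lambda>n. fst (coef \<eta> a b n)) (\<lambda>n. snd (coef \<eta> a b n))"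
proof -
  have cancel: "(real n + 1) * (real n + 2) * (x / ((real n + 1) * (real n + 2))) = x" for n x
  proof -
    have "0 < (real n + 1) * (real n + 2)" by simp
    thus ?thesis by (metis less_irrefl nonzero_mult_div_cancel_left times_divide_eq_right)
  qed
  show ?thesis
    unfolding power_solution_def add_2_eq_Suc' coef.simps fst_conv snd_conv cancel conv_def alt_def by simp
qed

text \<open>Each coefficient is a polynomial in the four initial values. Continuity of the boundary
  values will follow by uniform convergence.\<close>

lemma continuous_on_coef:
  assumes "continuous_on S f" "continuous_on S g"
  shows "continuous_on S (\<lambda>t. coef \<eta> (f t) (g t) n)"
proof (induction n rule: less_induct)
  case (less n)
  consider "n = 0" | "n = 1" | m where "n = Suc (Suc m)"
    by (metis One_nat_def not0_implies_Suc)
  thus ?case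
  proof cases
    case 3
    have "0 < (real m + 1) * (real m + 2)" by simp
    hence nz: "(real m + 1) * (real m + 2) \<noteq> 0" by (metis less_irrefl)
    show ?thesis unfolding 3 coef.simps using less.IH 3
      by (intro continuous_intros) (auto simp: nz)
  qed (use assms in auto)
qed

definition power_sum :: "(nat \<Rightarrow> real) \<Rightarrow> complex \<Rightarrow> complex" where
  "power_sum c z = (\<Sum>n. of_real (c n) * z ^ n)"

lemma negbin_mult: "negbin r p n * x ^ n = negbin (r * x) p n"
  by (simp add: negbin_def power_mult_distrib)

lemma summable_norm_power_sum:
  fixes z :: complex
  assumes "\<And>n. \<bar>c n\<bar> \<le> M * negbin r p n" "r \<ge> 0" "r * norm z < 1"
  shows "summable (\<lambda>n. norm (of_real (c n) * z ^ n))"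
proof (rule summable_comparison_test')
  show "summable (\<lambda>n. M * negbin (r * norm z) p n)"
    using assms by (intro summable_mult sums_summable[OF sums_negbin]) auto
  show "norm (norm (of_real (c n) * z ^ n)) \<le> M * negbin (r * norm z) p n" for n
    using mult_right_mono[OF assms(1)[of n], of "norm z ^ n"]
    by (simp add: norm_mult norm_power mult.assoc negbin_mult)
qed

lemma power_sum_sums:
  assumes "\<And>n. \<bar>c n\<bar> \<le> M * negbin r p n" "r \<ge> 0" "r * norm z < 1"
  shows "(\<lambda>n. of_real (c n) * z ^ n) sums power_sum c z"
  unfolding power_sum_def
  by (rule summable_sums[OF summable_norm_cancel[OF summable_norm_power_sum[OF assms]]])

lemma power_sum_conv:
  assumes "\<And>n. \<bar>a n\<bar> \<le> M * negbin r p n" "\<And>n. \<bar>b n\<bar> \<le> M' * negbin r q n" "r \<ge> 0" "r * norm z < 1"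
  shows "power_sum (conv a b) z = power_sum a z * power_sum b z"
proof -
  have "(\<Sum>k\<le>n. of_real (a k) * z ^ k * (of_real (b (n - k)) * z ^ (n - k))) = of_real (conv a b n) * z ^ n" for n
    unfolding conv_def of_real_sum sum_distrib_right
  proof (intro sum.cong refl)
    fix k assume "k \<in> {..n}"
    hence "z ^ n = z ^ k * z ^ (n - k)" by (simp flip: power_add)
    thus "of_real (a k) * z ^ k * (of_real (b (n - k)) * z ^ (n - k)) = of_real (a k * b (n - k)) * z ^ n"
      by simp
  qed
  thus ?thesis
    using Cauchy_product[OF summable_norm_power_sum summable_norm_power_sum, of a M r p z b M' r q z] assms
    by (simp add: power_sum_def)
qed

lemma power_sum_alt: "power_sum (alt c) z = power_sum c (- z)"
  by (simp add: power_sum_def alt_def power_minus[of z] mult_ac)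

lemma cnj_power_sum:
  assumes "\<And>n. \<bar>c n\<bar> \<le> M * negbin r p n" "r \<ge> 0" "r * norm z < 1"
  shows "cnj (power_sum c z) = power_sum c (cnj z)"
proof -
  have "(\<lambda>n. cnj (of_real (c n) * z ^ n)) sums cnj (power_sum c z)"
    using power_sum_sums[OF assms] by (simp only: sums_cnj)
  thus ?thesis by (simp add: power_sum_def sums_iff)
qed

lemma has_field_derivative_power_sum:
  assumes "\<And>n. \<bar>c n\<bar> \<le> M * negbin r p n" "r > 0" "r * norm z < 1"
  shows "(power_sum c has_field_derivative power_sum (\<lambda>n. (real n + 1) * c (n + 1)) z) (at z)"
proof -
  have "(power_sum c has_field_derivative (\<Sum>n. diffs (\<lambda>n. of_real (c n)) n * z ^ n)) (at z)"
    unfolding power_sum_def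
  proof (rule termdiffs_strong'[where K = "1 / r"])
    show "summable (\<lambda>n. complex_of_real (c n) * w ^ n)" if "norm w < 1 / r" for w
      using that assms by (intro sums_summable[OF power_sum_sums[of c M r p]]) (auto simp: field_simps)
  qed (use assms in \<open>auto simp: field_simps\<close>)
  thus ?thesis by (simp add: power_sum_def diffs_def add_ac)
qed

lemma abs_shift_le:
  assumes "\<And>n. \<bar>c n\<bar> \<le> M * negbin r p n"
  shows "\<bar>(real n + 1) * c (n + 1)\<bar> \<le> M * p * r * negbin r (p + 1) n"
proof -
  have "\<bar>(real n + 1) * c (n + 1)\<bar> \<le> (real n + 1) * (M * negbin r p (Suc n))"
    using assms[of "Suc n"] by (simp add: abs_mult mult_left_mono)
  also have "\<dots> = M * ((real n + 1) * negbin r p (Suc n))" by (simp only: mult_ac)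
  finally show ?thesis unfolding negbin_Suc by (simp add: mult_ac)
qed

text \<open>With z = ix, the second derivative in z is minus the one in x, which removes the minus
  signs of the system; on the imaginary axis \<open>power_sum U (- z)\<close> is the conjugate of
  \<open>power_sum U z\<close>.\<close>

lemma power_sum_solution:
  assumes sol: "power_solution \<eta> U V" and r: "r > 0" "r * norm z < 1"
    and bd: "\<And>n. \<bar>U n\<bar> \<le> M * negbin r 2 n" "\<And>n. \<bar>V n\<bar> \<le> M * negbin r 2 n"
  shows "(power_sum (\<lambda>n. (real n + 1) * U (n + 1)) has_field_derivative
           \<eta> * power_sum U z + power_sum V z * power_sum U (- z)) (at z)" (is ?U)
    and "(power_sum (\<lambda>n. (real n + 1) * V (n + 1)) has_field_derivative
           4 * \<eta> * power_sum V z + (power_sum U z)\<^sup>2) (at z)" (is ?V)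
proof -
  have sums: "power_sum (\<lambda>n. \<epsilon> * f n + conv g h n) z = \<epsilon> * power_sum f z + power_sum g z * power_sum h z"
    if "\<And>n. \<bar>f n\<bar> \<le> M * negbin r 2 n" "\<And>n. \<bar>g n\<bar> \<le> M * negbin r 2 n" "\<And>n. \<bar>h n\<bar> \<le> M * negbin r 2 n"
    for f g h and \<epsilon> :: real
  proof -
    have "(\<lambda>n. of_real (conv g h n) * z ^ n) sums power_sum (conv g h) z"
    proof (rule power_sum_sums)
      show "\<bar>conv g h n\<bar> \<le> M * M * negbin r 4 n" for n
        using abs_conv_le[of n g M r 2 h M 2] that by simp
    qed (use r in auto)
    moreover have "(\<lambda>n. of_real (f n) * z ^ n) sums power_sum f z"
      using that r by (intro power_sum_sums[of f M r 2]) auto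
    ultimately have "(\<lambda>n. of_real \<epsilon> * (of_real (f n) * z ^ n) + of_real (conv g h n) * z ^ n)
        sums (of_real \<epsilon> * power_sum f z + power_sum (conv g h) z)"
      by (intro sums_add sums_mult)
    moreover have "power_sum (conv g h) z = power_sum g z * power_sum h z"
      using that r by (intro power_sum_conv[where r = r]) auto
    moreover have "of_real \<epsilon> * (of_real (f n) * z ^ n) + of_real (conv g h n) * z ^ n
        = of_real (\<epsilon> * f n + conv g h n) * z ^ n" for n
      by (simp add: algebra_simps)
    ultimately have "(\<lambda>n. of_real (\<epsilon> * f n + conv g h n) * z ^ n)
        sums (of_real \<epsilon> * power_sum f z + power_sum g z * power_sum h z)"
      by (simp only:)
    thus ?thesis unfolding power_sum_def[of "\<lambda>n. \<epsilon> * f n + conv g h n"] by (rule sums_unique[symmetric])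
  qed
  have sh: "(\<lambda>n. (real n + 1) * ((real (n + 1) + 1) * f (n + 1 + 1))) = (\<lambda>n. (real n + 1) * (real n + 2) * f (n + 2))"
    for f :: "nat \<Rightarrow> real" by (simp add: fun_eq_iff add_ac)
  have "(power_sum (\<lambda>n. (real n + 1) * U (n + 1)) has_field_derivative
      power_sum (\<lambda>n. (real n + 1) * (real n + 2) * U (n + 2)) z) (at z)"
    "(power_sum (\<lambda>n. (real n + 1) * V (n + 1)) has_field_derivative
      power_sum (\<lambda>n. (real n + 1) * (real n + 2) * V (n + 2)) z) (at z)"
    using has_field_derivative_power_sum[OF abs_shift_le[OF bd(1)] r]
      has_field_derivative_power_sum[OF abs_shift_le[OF bd(2)] r] unfolding sh by auto
  moreover have "power_sum (\<lambda>n. \<eta> * U n + conv V (alt U) n) z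
      = \<eta> * power_sum U z + power_sum V z * power_sum U (- z)"
    using bd by (simp add: sums power_sum_alt)
  moreover have "power_sum (\<lambda>n. 4 * \<eta> * V n + conv U U n) z
      = of_real (4 * \<eta>) * power_sum V z + (power_sum U z)\<^sup>2"
    unfolding power2_eq_square by (intro sums bd)
  ultimately show ?U ?V
    unfolding power_solutionD[OF sol] by simp_all
qed

section \<open>Weak derivatives and norms\<close>

text \<open>Off the closed support the function vanishes on a neighbourhood, so the derivative has
  no larger support. This permits integrating by parts twice.\<close>

lemma test_function_on_deriv:
  assumes "test_function_on D \<phi>"
  shows "test_function_on D (deriv \<phi>)"
proof -
  let ?S = "closure {x. \<phi> x \<noteq> 0}"
  have "deriv \<phi> x = 0" if "x \<notin> ?S" for x
  proof -
    have "\<forall>\<^sub>F y in nhds x. y \<in> - ?S"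
      using that by (intro eventually_nhds_in_open) auto
    hence "\<forall>\<^sub>F y in nhds x. \<phi> y = 0"
      by eventually_elim (use closure_subset[of "{x. \<phi> x \<noteq> 0}"] in auto)
    hence "deriv \<phi> x = deriv (\<lambda>_. 0) x" by (rule deriv_cong_ev) simp
    thus ?thesis by simp
  qed
  hence sub: "closure {x. deriv \<phi> x \<noteq> 0} \<subseteq> ?S"
    by (intro closure_minimal) auto
  moreover have "compact (closure {x. deriv \<phi> x \<noteq> 0})"
    using compact_Int_closed[of ?S "closure {x. deriv \<phi> x \<noteq> 0}"] sub assms
    by (simp add: test_function_on_def Int_absorb1)
  moreover have "(deriv ^^ k) (deriv \<phi>) field_differentiable at x" for k x
    using assms unfolding test_function_on_def funpow_swap1[symmetric]
    by (metis funpow.simps(2) o_apply)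
  ultimately show ?thesis using assms unfolding test_function_on_def by blast
qed

lemma set_integrable_continuous_Ioo:
  fixes f :: "real \<Rightarrow> 'a :: euclidean_space"
  assumes "continuous_on {a..b} f"
  shows "set_integrable lebesgue {a<..<b} f"
  by (rule set_integrable_subset[OF absolutely_integrable_continuous_real[OF assms]]) auto

lemma LINT_continuous_Ioo:
  fixes f :: "real \<Rightarrow> 'a :: euclidean_space"
  assumes "continuous_on {a..b} f"
  shows "(LINT x:{a<..<b}|lebesgue. f x) = integral {a..b} f"
  using set_lebesgue_integral_eq_integral(2)[OF set_integrable_continuous_Ioo[OF assms]]
  by (simp add: integral_open_interval_real)

lemma locally_integrable_on_continuous:
  assumes "continuous_on {a..b} f"
  shows "locally_integrable_on f {a<..<b}"
  unfolding locally_integrable_on_def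
proof (intro allI impI)
  fix K assume "compact K \<and> K \<subseteq> {a<..<b}"
  thus "set_integrable lebesgue K f"
    by (intro set_integrable_subset[OF set_integrable_continuous_Ioo[OF assms]])
      (auto simp: fmeasurableD lmeasurable_compact)
qed

lemma L2_space_continuous:
  assumes "continuous_on {a..b} f"
  shows "f \<in> L2_space {a<..<b}"
proof -
  have "continuous_on {a..b} (\<lambda>x. (cmod (f x))\<^sup>2)"
    by (intro continuous_intros assms)
  hence "integrable (lebesgue_on {a<..<b}) (\<lambda>x. (cmod (f x))\<^sup>2)"
    by (intro absolutely_integrable_imp_integrable set_integrable_continuous_Ioo) auto
  moreover have "f \<in> borel_measurable (lebesgue_on {a<..<b})"
    by (rule continuous_imp_measurable_on_sets_lebesgue[OF continuous_on_subset[OF assms]]) auto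
  ultimately show ?thesis by (simp add: L2_space_def)
qed

lemma integration_by_parts_test_function:
  fixes f f' :: "real \<Rightarrow> complex"
  assumes phi: "test_function_on {a<..<b} \<phi>" and "a \<le> b"
    and f: "\<And>x. x \<in> {a..b} \<Longrightarrow> (f has_vector_derivative f' x) (at x)"
    and f': "continuous_on {a..b} f'"
  shows "(LINT x:{a<..<b}|lebesgue. deriv \<phi> x *\<^sub>R f x) = - (LINT x:{a<..<b}|lebesgue. \<phi> x *\<^sub>R f' x)"
proof -
  have d: "(\<phi> has_field_derivative deriv \<phi> x) (at x)" for x
    using phi unfolding test_function_on_def
    by (metis DERIV_deriv_iff_field_differentiable eq_id_iff funpow_0)
  have d': "(deriv \<phi> has_field_derivative deriv (deriv \<phi>) x) (at x)" for x
    using test_function_on_deriv[OF phi] unfolding test_function_on_def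
    by (metis DERIV_deriv_iff_field_differentiable eq_id_iff funpow_0)
  have cphi: "continuous_on {a..b} \<phi>" "continuous_on {a..b} (deriv \<phi>)"
    using d d' by (meson DERIV_isCont continuous_at_imp_continuous_on)+
  have cf: "continuous_on {a..b} f"
    using f by (meson continuous_at_imp_continuous_on has_vector_derivative_continuous)
  have 0: "\<phi> a = 0" "\<phi> b = 0"
    using phi closure_subset[of "{x. \<phi> x \<noteq> 0}"] unfolding test_function_on_def by auto
  have "((\<lambda>x. \<phi> x *\<^sub>R f' x + deriv \<phi> x *\<^sub>R f x) has_integral \<phi> b *\<^sub>R f b - \<phi> a *\<^sub>R f a) {a..b}"
    using \<open>a \<le> b\<close>
  proof (rule fundamental_theorem_of_calculus)
    fix x assume "x \<in> {a..b}"
    thus "((\<lambda>x. \<phi> x *\<^sub>R f x) has_vector_derivative \<phi> x *\<^sub>R f' x + deriv \<phi> x *\<^sub>R f x) (at x within {a..b})"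
      by (rule has_vector_derivative_scaleR[OF has_field_derivative_at_within[OF d]
            has_vector_derivative_at_within[OF f]])
  qed
  hence "integral {a..b} (\<lambda>x. \<phi> x *\<^sub>R f' x + deriv \<phi> x *\<^sub>R f x) = 0"
    using 0 by (simp add: integral_unique)
  moreover have c: "continuous_on {a..b} (\<lambda>x. \<phi> x *\<^sub>R f' x)" "continuous_on {a..b} (\<lambda>x. deriv \<phi> x *\<^sub>R f x)"
    by (intro continuous_intros cphi cf f')+
  ultimately show ?thesis
    by (simp add: LINT_continuous_Ioo integral_add integrable_continuous_interval eq_neg_iff_add_eq_0 add.commute)
qed

text \<open>Two-sided derivatives at the end points are available in the application because the
  power series converge beyond the interval; no limiting argument is needed there.\<close>

lemma weak_derivative_classical:
  assumes "a \<le> b" and f: "\<And>x. x \<in> {a..b} \<Longrightarrow> (f has_vector_derivative f' x) (at x)"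
    and f': "\<And>x. x \<in> {a..b} \<Longrightarrow> (f' has_vector_derivative f'' x) (at x)"
    and c: "continuous_on {a..b} f''"
  shows "weak_derivative {a<..<b} 1 f f'" "weak_derivative {a<..<b} 2 f f''"
proof -
  have cf: "continuous_on {a..b} f" "continuous_on {a..b} f'"
    using f f' by (meson continuous_at_imp_continuous_on has_vector_derivative_continuous)+
  show "weak_derivative {a<..<b} 1 f f'"
    unfolding weak_derivative_def
    using integration_by_parts_test_function[OF _ \<open>a \<le> b\<close> f cf(2)] cf
    by (auto intro!: locally_integrable_on_continuous)
  show "weak_derivative {a<..<b} 2 f f''"
    unfolding weak_derivative_def
  proof (intro conjI allI impI locally_integrable_on_continuous cf c)
    fix \<phi> assume t: "test_function_on {a<..<b} \<phi>"
    show "(LINT x:{a<..<b}|lebesgue. (deriv ^^ 2) \<phi> x *\<^sub>R f x)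
        = (- 1) ^ 2 * (LINT x:{a<..<b}|lebesgue. \<phi> x *\<^sub>R f'' x)"
      using integration_by_parts_test_function[OF test_function_on_deriv[OF t] \<open>a \<le> b\<close> f cf(2)]
        integration_by_parts_test_function[OF t \<open>a \<le> b\<close> f' c]
      by (simp add: numeral_2_eq_2)
  qed
qed

lemma H2_space_classical:
  assumes "a \<le> b" and "\<And>x. x \<in> {a..b} \<Longrightarrow> (f has_vector_derivative f' x) (at x)"
    and "\<And>x. x \<in> {a..b} \<Longrightarrow> (f' has_vector_derivative f'' x) (at x)"
    and "continuous_on {a..b} f''"
  shows "f \<in> H2_space {a<..<b}"
proof -
  have "continuous_on {a..b} f" "continuous_on {a..b} f'"
    using assms by (meson continuous_at_imp_continuous_on has_vector_derivative_continuous)+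
  thus ?thesis
    using weak_derivative_classical[OF assms] L2_space_continuous assms(4)
    unfolding H2_space_def by auto
qed

text \<open>All other summands are squares and are dropped, so the choice hidden in
  \<open>weak_deriv\<close> never has to be evaluated.\<close>

lemma L2_norm_le_H2_L2_norm: "L2_norm_on D u \<le> H2_L2_norm_on D u v"
proof -
  have "L2_norm_on D u \<ge> 0" by (simp add: L2_norm_on_def integral_nonneg_AE)
  hence "L2_norm_on D u \<le> H2_norm_on D u"
    unfolding H2_norm_on_def by (intro real_le_rsqrt) (simp add: add_increasing2)
  also have "\<dots> \<le> H2_L2_norm_on D u v"
    unfolding H2_L2_norm_on_def by (intro real_le_rsqrt) simp
  finally show ?thesis .
qed

lemma L2_norm_ge:
  assumes "f \<in> L2_space {a<..<b}" "{c..d} \<subseteq> {a<..<b}" "c \<le> d"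
    and "\<And>x. x \<in> {c..d} \<Longrightarrow> m \<le> cmod (f x)" "0 \<le> m"
  shows "m * sqrt (d - c) \<le> L2_norm_on {a<..<b} f"
proof -
  let ?L = "lebesgue_on {a<..<b}"
  have meas: "{c..d} \<in> sets ?L" using assms by (auto simp: sets_restrict_space_iff)
  have "emeasure ?L {c..d} = emeasure lebesgue {c..d}"
    using assms by (intro emeasure_restrict_space) auto
  hence em: "emeasure ?L {c..d} = ennreal (d - c)" using \<open>c \<le> d\<close> by simp
  hence "measure ?L {c..d} = d - c" using \<open>c \<le> d\<close> by (simp add: measure_def)
  hence "m\<^sup>2 * (d - c) = (LINT x|?L. m\<^sup>2 * indicator {c..d} x)"
    using assms(2) by (simp add: Int_absorb2)
  also have "\<dots> \<le> (LINT x|?L. (cmod (f x))\<^sup>2)"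
  proof (rule integral_mono)
    show "integrable ?L (\<lambda>x. m\<^sup>2 * indicator {c..d} x)"
      using meas em by (intro integrable_mult_right integrable_real_indicator) auto
    show "integrable ?L (\<lambda>x. (cmod (f x))\<^sup>2)" using assms by (simp add: L2_space_def)
    show "m\<^sup>2 * indicator {c..d} x \<le> (cmod (f x))\<^sup>2" for x
      using assms by (auto simp: indicator_def intro: power_mono)
  qed
  finally have "sqrt (m\<^sup>2 * (d - c)) \<le> L2_norm_on {a<..<b} f"
    unfolding L2_norm_on_def by (rule real_sqrt_le_mono)
  thus ?thesis using assms by (simp add: real_sqrt_mult)
qed

section \<open>From power series to eigenfunctions\<close>

text \<open>Combines the change of variable from (0,1) to (-1,1) with the factor i that makes the
  coefficients real.\<close>

definition segment :: "real \<Rightarrow> complex" where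
  "segment x = \<i> * of_real (2 * x - 1)"

lemma norm_segment: "norm (segment x) = \<bar>2 * x - 1\<bar>"
  unfolding segment_def norm_mult norm_of_real by simp

lemma cnj_segment: "cnj (segment x) = - segment x"
  by (simp add: segment_def)

lemma has_vector_derivative_power_sum_segment:
  assumes "\<And>n. \<bar>c n\<bar> \<le> M * negbin r p n" "r > 0" "r * \<bar>2 * x - 1\<bar> < 1"
  shows "((\<lambda>x. K * power_sum c (segment x)) has_vector_derivative
    2 * \<i> * K * power_sum (\<lambda>n. (real n + 1) * c (n + 1)) (segment x)) (at x)"
proof -
  have "(segment has_vector_derivative 2 * \<i>) (at x)"
    unfolding segment_def by (auto intro!: derivative_eq_intros simp: scaleR_conv_of_real)
  from field_vector_diff_chain_at[OF this has_field_derivative_power_sum[OF assms(1,2)]]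
  have "((\<lambda>x. power_sum c (segment x)) has_vector_derivative
      2 * \<i> * power_sum (\<lambda>n. (real n + 1) * c (n + 1)) (segment x)) (at x)"
    using assms(3) by (simp add: norm_segment o_def)
  from has_vector_derivative_mult_right[OF this, of K] show ?thesis by (simp add: mult_ac)
qed

lemma open_segment_domain: "open {x :: real. r * \<bar>2 * x - 1\<bar> < 1}"
  by (intro open_Collect_less continuous_intros)

lemma segment_domain: "0 < r \<Longrightarrow> r < 1 \<Longrightarrow> x \<in> {0..1} \<Longrightarrow> r * \<bar>2 * x - 1\<bar> < (1::real)"
  by (rule le_less_trans[of _ "r * 1"]) (auto intro!: mult_left_mono)

lemma D1_power_sum_segment:
  assumes "\<And>n. \<bar>c n\<bar> \<le> M * negbin r p n" "r > 0" "r * \<bar>2 * x - 1\<bar> < 1"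
  shows "D1 (\<lambda>x. K * power_sum c (segment x)) x
    = 2 * \<i> * K * power_sum (\<lambda>n. (real n + 1) * c (n + 1)) (segment x)"
  by (rule vector_derivative_at[OF has_vector_derivative_power_sum_segment[OF assms]])

lemma second_derivative_power_sum_segment:
  assumes bd: "\<And>n. \<bar>c n\<bar> \<le> M * negbin r p n" "r > 0" "r * \<bar>2 * x - 1\<bar> < 1"
  shows "(D1 (\<lambda>x. K * power_sum c (segment x)) has_vector_derivative
    - 4 * K * power_sum (\<lambda>n. (real n + 1) * ((real (n + 1) + 1) * c (n + 1 + 1))) (segment x)) (at x)"
proof (rule has_vector_derivative_transform_within_open)
  show "((\<lambda>x. 2 * \<i> * K * power_sum (\<lambda>n. (real n + 1) * c (n + 1)) (segment x)) has_vector_derivative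
      - 4 * K * power_sum (\<lambda>n. (real n + 1) * ((real (n + 1) + 1) * c (n + 1 + 1))) (segment x)) (at x)"
    using has_vector_derivative_power_sum_segment[OF abs_shift_le[OF bd(1)] bd(2,3), of "2 * \<i> * K"]
    by simp
qed (use assms in \<open>auto simp: D1_power_sum_segment[OF bd(1,2)] intro: open_segment_domain\<close>)

text \<open>The scaling factors are forced: the substitution 2x - 1 multiplies second derivatives by
  4, and matching both right-hand sides gives the two equations \<open>ab\<close>. Conditions at z =
  i suffice, since real coefficients make the values at -i their conjugates.\<close>

lemma eigenfunction_of_power_solution:
  fixes q \<chi>\<^sub>1 \<chi>\<^sub>2 \<omega> r M :: real
  assumes pos: "\<chi>\<^sub>1 > 0" "\<chi>\<^sub>2 > 0" "\<omega> > 0" and r: "0 < r" "r < 1"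
    and sol: "power_solution (\<omega>\<^sup>2 * q / 4) U V"
    and bd: "\<And>n. \<bar>U n\<bar> \<le> M * negbin r 2 n" "\<And>n. \<bar>V n\<bar> \<le> M * negbin r 2 n"
    and bc: "power_sum V \<i> = 0" "power_sum (\<lambda>n. (real n + 1) * V (n + 1)) \<i> = 0"
    and nz: "U 0 \<noteq> 0"
  defines "E\<^sub>1 \<equiv> \<lambda>x. of_real (4 / (\<omega>\<^sup>2 * sqrt (\<chi>\<^sub>1 * \<chi>\<^sub>2))) * power_sum U (segment x)"
    and "E\<^sub>2 \<equiv> \<lambda>x. of_real (4 / (\<omega>\<^sup>2 * \<chi>\<^sub>1)) * power_sum V (segment x)"
  shows "eigenfunction q \<chi>\<^sub>1 \<chi>\<^sub>2 \<omega> E\<^sub>1 E\<^sub>2" and "E\<^sub>1 \<in> H2_space {0<..<1}" and "E\<^sub>2 \<in> L2_space {0<..<1}"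
proof -
  define \<eta> where "\<eta> = \<omega>\<^sup>2 * q / 4"
  define a b where "a = 4 / (\<omega>\<^sup>2 * sqrt (\<chi>\<^sub>1 * \<chi>\<^sub>2))" and "b = 4 / (\<omega>\<^sup>2 * \<chi>\<^sub>1)"
  have E: "E\<^sub>1 = (\<lambda>x. of_real a * power_sum U (segment x))" "E\<^sub>2 = (\<lambda>x. of_real b * power_sum V (segment x))"
    by (simp_all add: E\<^sub>1_def E\<^sub>2_def a_def b_def)
  have ab: "\<omega>\<^sup>2 * \<chi>\<^sub>1 * b = 4" "\<omega>\<^sup>2 * \<chi>\<^sub>2 * a\<^sup>2 = 4 * b"
    using pos by (simp_all add: a_def b_def field_simps power2_eq_square)
  note shift_bd = abs_shift_le[OF bd(1)] abs_shift_le[OF bd(2)]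
  note dom = segment_domain[OF r]
  \<comment> \<open>The series differentiated twice term by term is identified with the right-hand
    side of the equation by uniqueness of derivatives.\<close>
  have sh: "power_sum (\<lambda>n. (real n + 1) * ((real (n + 1) + 1) * c (n + 1 + 1))) z = G"
    if "(power_sum (\<lambda>n. (real n + 1) * c (n + 1)) has_field_derivative G) (at z)" "r * norm z < 1"
      "\<And>n. \<bar>c n\<bar> \<le> M * negbin r 2 n"
    for G z and c :: "nat \<Rightarrow> real"
    using DERIV_unique[OF has_field_derivative_power_sum[OF abs_shift_le[OF that(3)] r(1) that(2)] that(1)] .
  have d1: "(E\<^sub>1 has_vector_derivative D1 E\<^sub>1 x) (at x)" "(E\<^sub>2 has_vector_derivative D1 E\<^sub>2 x) (at x)"
    if "x \<in> {0..1}" for x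
    using has_vector_derivative_power_sum_segment[OF bd(1) r(1) dom[OF that], of "of_real a"]
      has_vector_derivative_power_sum_segment[OF bd(2) r(1) dom[OF that], of "of_real b"]
    unfolding E by (auto intro: vector_derivative_at[THEN ssubst])
  have d2: "(D1 E\<^sub>1 has_vector_derivative
      - 4 * of_real a * (of_real \<eta> * power_sum U (segment x) + power_sum V (segment x) * power_sum U (- segment x))) (at x)"
    "(D1 E\<^sub>2 has_vector_derivative
      - 4 * of_real b * (4 * of_real \<eta> * power_sum V (segment x) + (power_sum U (segment x))\<^sup>2)) (at x)"
    if x: "x \<in> {0..1}" for x
  proof -
    have rx: "r * norm (segment x) < 1" using dom[OF x] by (simp add: norm_segment)
    note sol' = sol[folded \<eta>_def]
    show "(D1 E\<^sub>1 has_vector_derivative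
      - 4 * of_real a * (of_real \<eta> * power_sum U (segment x) + power_sum V (segment x) * power_sum U (- segment x))) (at x)"
      using second_derivative_power_sum_segment[OF bd(1) r(1) dom[OF x], of "of_real a"]
      unfolding sh[OF power_sum_solution(1)[OF sol' r(1) rx bd] rx bd(1)] E .
    show "(D1 E\<^sub>2 has_vector_derivative
      - 4 * of_real b * (4 * of_real \<eta> * power_sum V (segment x) + (power_sum U (segment x))\<^sup>2)) (at x)"
      using second_derivative_power_sum_segment[OF bd(2) r(1) dom[OF x], of "of_real b"]
      unfolding sh[OF power_sum_solution(2)[OF sol' r(1) rx bd] rx bd(2)] E .
  qed
  have cont: "continuous_on {0..1} E\<^sub>1" "continuous_on {0..1} E\<^sub>2"
    using d1 by (meson continuous_at_imp_continuous_on has_vector_derivative_continuous)+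
  have line: "continuous_on {0..1} (\<lambda>x. power_sum U (segment x))" "continuous_on {0..1} (\<lambda>x. power_sum V (segment x))"
    "continuous_on {0..1} (\<lambda>x. power_sum U (- segment x))"
  proof -
    show "continuous_on {0..1} (\<lambda>x. power_sum U (segment x))"
      using has_vector_derivative_power_sum_segment[OF bd(1) r(1) dom, of _ 1]
      by (simp only: mult_1) (meson continuous_at_imp_continuous_on has_vector_derivative_continuous)
    show "continuous_on {0..1} (\<lambda>x. power_sum V (segment x))"
      using has_vector_derivative_power_sum_segment[OF bd(2) r(1) dom, of _ 1]
      by (simp only: mult_1) (meson continuous_at_imp_continuous_on has_vector_derivative_continuous)
    show "continuous_on {0..1} (\<lambda>x. power_sum U (- segment x))"
      using has_vector_derivative_power_sum_segment[of "alt U" M r 2, OF _ r(1) dom, of _ 1] bd(1)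
      unfolding power_sum_alt
      by (simp only: mult_1 abs_alt) (meson continuous_at_imp_continuous_on has_vector_derivative_continuous)
  qed
  show "E\<^sub>1 \<in> H2_space {0<..<1}"
    by (rule H2_space_classical[OF _ d1(1) d2(1)]) (auto intro!: continuous_intros line)
  show "E\<^sub>2 \<in> L2_space {0<..<1}"
    by (rule L2_space_continuous[OF cont(2)])
  have dd: "D1 (D1 E\<^sub>1) x = - 4 * of_real a * (of_real \<eta> * power_sum U (segment x) + power_sum V (segment x) * power_sum U (- segment x))"
    "D1 (D1 E\<^sub>2) x = - 4 * of_real b * (4 * of_real \<eta> * power_sum V (segment x) + (power_sum U (segment x))\<^sup>2)"
    if "x \<in> {0..1}" for x
    using d2[OF that] by (auto intro: vector_derivative_at)
  have e1: "D1 (D1 E\<^sub>1) x + of_real (\<omega>\<^sup>2 * q) * E\<^sub>1 x = - of_real (\<omega>\<^sup>2 * \<chi>\<^sub>1) * E\<^sub>2 x * cnj (E\<^sub>1 x)"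
    if x: "x \<in> {0..1}" for x
  proof -
    have rx: "r * norm (segment x) < 1" using dom[OF x] by (simp add: norm_segment)
    have c: "cnj (E\<^sub>1 x) = of_real a * power_sum U (- segment x)"
      using cnj_power_sum[OF bd(1) less_imp_le[OF r(1)] rx] by (simp add: E cnj_segment)
    have q: "\<omega>\<^sup>2 * q = 4 * \<eta>" by (simp add: \<eta>_def)
    have "- of_real (\<omega>\<^sup>2 * \<chi>\<^sub>1) * E\<^sub>2 x * cnj (E\<^sub>1 x)
        = - of_real (\<omega>\<^sup>2 * \<chi>\<^sub>1 * b) * of_real a * (power_sum V (segment x) * power_sum U (- segment x))"
      unfolding c by (simp add: E)
    hence rhs: "- of_real (\<omega>\<^sup>2 * \<chi>\<^sub>1) * E\<^sub>2 x * cnj (E\<^sub>1 x)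
        = - 4 * of_real a * (power_sum V (segment x) * power_sum U (- segment x))"
      unfolding ab by simp
    show ?thesis unfolding rhs dd[OF x] q by (simp add: E algebra_simps)
  qed
  have e2: "D1 (D1 E\<^sub>2) x + of_real (4 * \<omega>\<^sup>2 * q) * E\<^sub>2 x = - of_real (\<omega>\<^sup>2 * \<chi>\<^sub>2) * (E\<^sub>1 x)\<^sup>2"
    if x: "x \<in> {0..1}" for x
  proof -
    have q: "4 * \<omega>\<^sup>2 * q = 16 * \<eta>" by (simp add: \<eta>_def)
    have "- of_real (\<omega>\<^sup>2 * \<chi>\<^sub>2) * (E\<^sub>1 x)\<^sup>2 = - of_real (\<omega>\<^sup>2 * \<chi>\<^sub>2 * a\<^sup>2) * (power_sum U (segment x))\<^sup>2"
      by (simp add: E power_mult_distrib)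
    hence rhs: "- of_real (\<omega>\<^sup>2 * \<chi>\<^sub>2) * (E\<^sub>1 x)\<^sup>2 = - of_real (4 * b) * (power_sum U (segment x))\<^sup>2"
      unfolding ab .
    show ?thesis unfolding rhs dd[OF x] q by (simp add: E algebra_simps)
  qed
  have ends: "segment 0 = cnj \<i>" "segment 1 = \<i>" by (simp_all add: segment_def)
  have bc0: "power_sum V (cnj \<i>) = 0" "power_sum (\<lambda>n. (real n + 1) * V (n + 1)) (cnj \<i>) = 0"
    using cnj_power_sum[OF bd(2), of \<i>] cnj_power_sum[OF shift_bd(2), of \<i>] bc r by auto
  have D1E: "D1 E\<^sub>2 x = 2 * \<i> * of_real b * power_sum (\<lambda>n. (real n + 1) * V (n + 1)) (segment x)" if "x \<in> {0..1}" for x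
    unfolding E by (rule D1_power_sum_segment[OF bd(2) r(1) dom[OF that]])
  have z: "E\<^sub>2 0 = 0" "E\<^sub>2 1 = 0" "D1 E\<^sub>2 0 = 0" "D1 E\<^sub>2 1 = 0"
    using bc bc0 ends by (simp_all add: E(2)[THEN fun_cong] D1E)
  \<comment> \<open>\<open>E\<^sub>2\<close> and its derivative are continuous across the end
    points, so the one-sided limits are the values found in \<open>z\<close>.\<close>
  have "isCont E\<^sub>2 0" "isCont E\<^sub>2 1" "isCont (D1 E\<^sub>2) 0" "isCont (D1 E\<^sub>2) 1"
    using d1(2)[of 0] d1(2)[of 1] d2(2)[of 0] d2(2)[of 1]
    by (auto dest!: has_vector_derivative_continuous)
  hence lims: "(E\<^sub>2 \<longlongrightarrow> 0) (at 0)" "(E\<^sub>2 \<longlongrightarrow> 0) (at 1)" "(D1 E\<^sub>2 \<longlongrightarrow> 0) (at 0)" "(D1 E\<^sub>2 \<longlongrightarrow> 0) (at 1)"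
    unfolding isCont_def z by simp_all
  have diff: "E\<^sub>1 differentiable at x" "E\<^sub>2 differentiable at x"
      "D1 E\<^sub>1 differentiable at x" "D1 E\<^sub>2 differentiable at x" if "0 < x" "x < 1" for x
    using that d1[of x] d2[of x] by (auto intro: differentiableI_vector)
  have "solves_problem q \<chi>\<^sub>1 \<chi>\<^sub>2 \<omega> E\<^sub>1 E\<^sub>2"
    unfolding solves_problem_def twice_differentiable_in_def
    using lims[unfolded filterlim_at_split] e1 e2 by (auto intro: diff)
  \<comment> \<open>The midpoint corresponds to z = 0, where the series reduces to
    \<open>U 0\<close>.\<close>
  moreover have "E\<^sub>1 (1 / 2) \<noteq> 0"
  proof -
    have "power_sum U 0 = of_real (U 0)"
      unfolding power_sum_def by (subst suminf_finite[of "{0}"]) (auto simp: power_0_left)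
    thus ?thesis using nz pos by (simp add: E a_def segment_def)
  qed
  ultimately show "eigenfunction q \<chi>\<^sub>1 \<chi>\<^sub>2 \<omega> E\<^sub>1 E\<^sub>2"
    unfolding eigenfunction_def by (auto intro!: bexI[of _ "1 / 2"])
qed

section \<open>Verified computation of boundary values\<close>

text \<open>Fixed-point arithmetic with denominator \<open>S\<close> for the case \<open>\<eta> = 0\<close> of the recursion.\<close>

fun rounded_coef :: "int \<Rightarrow> int \<times> int \<Rightarrow> int \<times> int \<Rightarrow> nat \<Rightarrow> int \<times> int" where
  "rounded_coef S a b 0 = a"
| "rounded_coef S a b (Suc 0) = b"
| "rounded_coef S a b (Suc (Suc n)) =
    ((\<Sum>k\<le>n. snd (rounded_coef S a b k) * ((-1) ^ (n - k) * fst (rounded_coef S a b (n - k))))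
        div ((int n + 1) * (int n + 2) * S),
     (\<Sum>k\<le>n. fst (rounded_coef S a b k) * fst (rounded_coef S a b (n - k)))
        div ((int n + 1) * (int n + 2) * S))"

fun dot :: "int list \<Rightarrow> int list \<Rightarrow> int" where
  "dot (x # xs) (y # ys) = x * y + dot xs ys"
| "dot _ _ = 0"

fun alternate :: "int \<Rightarrow> int list \<Rightarrow> int list" where
  "alternate s [] = []"
| "alternate s (x # xs) = s * x # alternate (- s) xs"

text \<open>The lists hold the coefficients up to index \<open>n\<close> in reverse order, \<open>a\<close> and \<open>b\<close> those of
  index \<open>n + 1\<close>.\<close>

fun run :: "nat \<Rightarrow> int \<Rightarrow> int \<Rightarrow> int \<Rightarrow> int \<Rightarrow> int list \<Rightarrow> int list \<Rightarrow> int list \<times> int list" where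
  "run 0 n S a b us vs = (rev (a # us), rev (b # vs))"
| "run (Suc k) n S a b us vs =
    run k (n + 1) S (dot vs (alternate 1 (rev us)) div ((n + 1) * (n + 2) * S))
      (dot us (rev us) div ((n + 1) * (n + 2) * S)) (a # us) (b # vs)"

text \<open>The margin \<open>300\<close> absorbs the accumulated rounding error, which is at most
  \<open>negbin (9 / 10) 4 n\<close> units for \<open>n \<le> 98\<close>.\<close>

fun geometric_ok :: "int \<Rightarrow> int list \<Rightarrow> bool" where
  "geometric_ok B [] = True"
| "geometric_ok B (x # xs) = (\<bar>x\<bar> + 300 \<le> B \<and> geometric_ok (B * 76 div 100) xs)"

text \<open>Started at n = 1 with P equal to 6 r^2 in units of 1/S, this tests against the
  coefficients 6 r^2 (n + 1) r^n of W for r = 9/10. Rounding the bound down only makes the test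
  stricter.\<close>

fun majorant_ok :: "int \<Rightarrow> int \<Rightarrow> int list \<Rightarrow> bool" where
  "majorant_ok n P [] = True"
| "majorant_ok n P (x # xs) = (\<bar>x\<bar> \<le> n * P \<and> majorant_ok (n + 1) (P * 9 div 10) xs)"

text \<open>Real and imaginary part of \<open>\<Sum>x\<^sub>n \<i>\<^sup>n\<close>.\<close>

fun at_ii :: "int list \<Rightarrow> int \<times> int" where
  "at_ii [] = (0, 0)"
| "at_ii (x # xs) = (case at_ii xs of (p, q) \<Rightarrow> (x - q, p))"

fun weighted :: "int \<Rightarrow> int list \<Rightarrow> int list" where
  "weighted n [] = []"
| "weighted n (x # xs) = n * x # weighted (n + 1) xs"

fun near :: "int \<times> int \<Rightarrow> int \<times> int \<Rightarrow> bool" where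
  "near (a, b) (c, d) = (\<bar>a - c\<bar> \<le> 5000 \<and> \<bar>b - d\<bar> \<le> 5000)"

text \<open>97 steps from the indices 0 and 1 reach index 98. \<open>majorant_ok\<close> is what the
  comparison with the exact solution requires, with 486 * 10^11 standing for 6 (9/10)^2;
  \<open>geometric_ok\<close> serves to control the tail of the series.\<close>

definition verified :: "int \<times> int \<Rightarrow> int \<times> int \<Rightarrow> int \<times> int \<Rightarrow> int \<times> int \<Rightarrow> bool" where
  "verified a b v w \<longleftrightarrow> (case run 97 0 (10 ^ 13) (fst b) (snd b) [fst a] [snd a] of (us, vs) \<Rightarrow>
     geometric_ok (55 * 10 ^ 13) us \<and> geometric_ok (55 * 10 ^ 13) vs \<and>
     majorant_ok 1 (486 * 10 ^ 11) us \<and> majorant_ok 1 (486 * 10 ^ 11) vs \<and>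
     near (at_ii vs) v \<and> near (at_ii (weighted 0 vs)) w)"

section \<open>Soundness of the integer computation\<close>

lemma length_alternate [simp]: "length (alternate s xs) = length xs"
  by (induction s xs rule: alternate.induct) auto

lemma nth_alternate: "i < length xs \<Longrightarrow> alternate s xs ! i = s * ((-1) ^ i * xs ! i)"
  by (induction s xs arbitrary: i rule: alternate.induct) (auto simp: nth_Cons split: nat.split)

lemma length_weighted [simp]: "length (weighted n xs) = length xs"
  by (induction n xs rule: weighted.induct) auto

lemma nth_weighted: "i < length xs \<Longrightarrow> weighted n xs ! i = (n + int i) * xs ! i"
  by (induction n xs arbitrary: i rule: weighted.induct) (auto simp: nth_Cons split: nat.split)

lemma dot_eq_sum: "length xs = length ys \<Longrightarrow> dot xs ys = (\<Sum>i<length xs. xs ! i * ys ! i)"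
  by (induction xs ys rule: dot.induct) (auto simp: sum.lessThan_Suc_shift simp del: sum.lessThan_Suc)

lemma at_ii_eq_sum:
  "Complex (of_int (fst (at_ii xs))) (of_int (snd (at_ii xs))) = (\<Sum>i<length xs. of_int (xs ! i) * \<i> ^ i)"
proof (induction xs)
  case (Cons x xs)
  have "(\<Sum>i<length (x # xs). of_int ((x # xs) ! i) * \<i> ^ i)
      = of_int x + \<i> * (\<Sum>i<length xs. of_int (xs ! i) * \<i> ^ i)"
    by (simp add: sum.lessThan_Suc_shift sum_distrib_left mult_ac del: sum.lessThan_Suc)
  thus ?case unfolding Cons.IH[symmetric] by (auto simp: complex_eq_iff split: prod.split)
qed (simp add: complex_eq_iff)

lemma geometric_ok_bound:
  "geometric_ok B xs \<Longrightarrow> i < length xs \<Longrightarrow> real_of_int \<bar>xs ! i\<bar> + 300 \<le> of_int B * (19 / 25) ^ i"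
proof (induction B xs arbitrary: i rule: geometric_ok.induct)
  case (2 B x xs)
  show ?case
  proof (cases i)
    case 0
    have "real_of_int (\<bar>x\<bar> + 300) \<le> of_int B" using 2 by (intro of_int_le_iff[THEN iffD2]) auto
    thus ?thesis by (simp add: 0)
  next
    case (Suc j)
    have "real_of_int (B * 76 div 100) \<le> of_int B * (19 / 25)"
      using real_of_int_div4[of "B * 76" 100] by simp
    hence *: "real_of_int (B * 76 div 100) * (19 / 25) ^ j \<le> of_int B * (19 / 25) * (19 / 25) ^ j"
      by (rule mult_right_mono) simp
    have "real_of_int \<bar>xs ! j\<bar> + 300 \<le> real_of_int (B * 76 div 100) * (19 / 25) ^ j"
      using "2.IH"[of j] "2.prems" Suc by auto
    also note *
    finally show ?thesis by (simp add: Suc)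
  qed
qed simp

lemma majorant_ok_bound:
  "majorant_ok n P xs \<Longrightarrow> n \<ge> 0 \<Longrightarrow> i < length xs \<Longrightarrow>
    real_of_int \<bar>xs ! i\<bar> \<le> (of_int n + real i) * (of_int P * (9 / 10) ^ i)"
proof (induction n P xs arbitrary: i rule: majorant_ok.induct)
  case (2 n P x xs)
  show ?case
  proof (cases i)
    case 0
    have "real_of_int \<bar>x\<bar> \<le> of_int (n * P)" using 2 by (intro of_int_le_iff[THEN iffD2]) auto
    thus ?thesis by (simp add: 0)
  next
    case (Suc j)
    have "real_of_int (P * 9 div 10) \<le> of_int P * (9 / 10)"
      using real_of_int_div4[of "P * 9" 10] by simp
    hence "real_of_int (P * 9 div 10) * (9 / 10) ^ j \<le> of_int P * (9 / 10) * (9 / 10) ^ j"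
      by (rule mult_right_mono) simp
    hence "(of_int n + 1 + real j) * (real_of_int (P * 9 div 10) * (9 / 10) ^ j)
        \<le> (of_int n + 1 + real j) * (of_int P * (9 / 10) * (9 / 10) ^ j)"
      using "2.prems" by (intro mult_left_mono) auto
    moreover have "real_of_int \<bar>xs ! j\<bar>
        \<le> (of_int n + 1 + real j) * (real_of_int (P * 9 div 10) * (9 / 10) ^ j)"
      using "2.IH"[of j] "2.prems" Suc by auto
    ultimately have "real_of_int \<bar>xs ! j\<bar> \<le> (of_int n + 1 + real j) * (of_int P * (9 / 10) * (9 / 10) ^ j)"
      by linarith
    thus ?thesis by (simp add: Suc add_ac)
  qed
qed simp

text \<open>One list runs downwards and the other upwards in the index, so the scalar products in
  \<open>run\<close> are the convolution sums of \<open>rounded_coef\<close> up to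
  reindexing.\<close>

lemma run_eq:
  fixes S :: int and a b :: "int \<times> int"
  defines "A \<equiv> \<lambda>n. fst (rounded_coef S a b n)" and "B \<equiv> \<lambda>n. snd (rounded_coef S a b n)"
  shows "run k (int n) S (A (Suc n)) (B (Suc n)) (map A (rev [0..<Suc n])) (map B (rev [0..<Suc n]))
    = (map A [0..<n + k + 2], map B [0..<n + k + 2])"
proof (induction k arbitrary: n)
  case 0
  show ?case by (simp add: rev_map)
next
  case (Suc k)
  have rev_eq: "rev (map A (rev [0..<Suc n])) = map A [0..<Suc n]"
    by (simp only: rev_map rev_rev_ident)
  have nth: "rev [0..<Suc n] ! i = n - i" if "i < Suc n" for i
    using that by (simp add: rev_nth del: upt_Suc)
  have "dot (map B (rev [0..<Suc n])) (alternate 1 (rev (map A (rev [0..<Suc n]))))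
      = (\<Sum>i<Suc n. B (Suc n - Suc i) * ((-1) ^ i * A i))"
    unfolding rev_eq
    by (subst dot_eq_sum) (auto simp: nth nth_alternate simp del: upt_Suc sum.lessThan_Suc intro!: sum.cong)
  also have "\<dots> = (\<Sum>i<Suc n. (\<lambda>k. B k * ((-1) ^ (n - k) * A (n - k))) (Suc n - Suc i))"
    by (intro sum.cong) auto
  also have "\<dots> = (\<Sum>k\<le>n. B k * ((-1) ^ (n - k) * A (n - k)))"
    by (subst sum.nat_diff_reindex) (simp only: lessThan_Suc_atMost)
  finally have 1: "dot (map B (rev [0..<Suc n])) (alternate 1 (rev (map A (rev [0..<Suc n]))))
      div ((int n + 1) * (int n + 2) * S) = A (Suc (Suc n))"
    by (simp add: A_def B_def)
  have "dot (map A (rev [0..<Suc n])) (rev (map A (rev [0..<Suc n])))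
      = (\<Sum>i<Suc n. A (Suc n - Suc i) * A i)"
    unfolding rev_eq
    by (subst dot_eq_sum) (auto simp: nth simp del: upt_Suc sum.lessThan_Suc intro!: sum.cong)
  also have "\<dots> = (\<Sum>i<Suc n. (\<lambda>k. A k * A (n - k)) (Suc n - Suc i))"
    by (intro sum.cong) auto
  also have "\<dots> = (\<Sum>k\<le>n. A k * A (n - k))"
    by (subst sum.nat_diff_reindex) (simp only: lessThan_Suc_atMost)
  finally have 2: "dot (map A (rev [0..<Suc n])) (rev (map A (rev [0..<Suc n])))
      div ((int n + 1) * (int n + 2) * S) = B (Suc (Suc n))"
    by (simp add: A_def B_def)
  have cons: "f (Suc n) # map f (rev [0..<Suc n]) = map f (rev [0..<Suc (Suc n)])" for f :: "nat \<Rightarrow> int"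
    by simp
  show ?case
    unfolding run.simps 1 2 cons using Suc.IH[of "Suc n"] by (simp add: add_ac del: upt_Suc)
qed

lemma negbin_4: "negbin r 4 n = (real n + 1) * (real n + 2) * (real n + 3) / 6 * r ^ n"
proof (induction n)
  case (Suc n)
  have "(real n + 1) * negbin r 4 (Suc n) = (4 + real n) * r * negbin r 4 n"
    by (simp add: negbin_def pochhammer_Suc divide_simps)
  also have "\<dots> = (real n + 1) * ((real n + 2) * (real n + 3) * (real n + 4) / 6 * r ^ Suc n)"
    unfolding Suc.IH by (simp add: algebra_simps)
  finally have "negbin r 4 (Suc n) = (real n + 2) * (real n + 3) * (real n + 4) / 6 * r ^ Suc n"
    by (subst (asm) mult_left_cancel) linarith+
  thus ?case by (simp add: add_ac)
qed simp

text \<open>300 is the margin in \<open>geometric_ok\<close>. The lower bound 5/2 = 20/8 lets a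
  rounding error of one unit per coefficient fit into the share 8 of 20 that
  \<open>difference_bound\<close> grants to defects for p = 4.\<close>

lemma negbin_4_range:
  assumes "n \<le> 98"
  shows "negbin (9 / 10) 4 n \<le> 300" and "n \<ge> 2 \<Longrightarrow> 5 / 2 \<le> negbin (9 / 10) 4 n"
proof -
  have "\<forall>m \<in> set [0..<99]. (int m + 1) * (int m + 2) * (int m + 3) * 9 ^ m \<le> 1800 * 10 ^ m \<and>
     (m < 2 \<or> 15 * 10 ^ m \<le> (int m + 1) * (int m + 2) * (int m + 3) * 9 ^ m)"
    by code_simp
  moreover have "n \<in> set [0..<99]" using assms by simp
  ultimately have *: "(int n + 1) * (int n + 2) * (int n + 3) * 9 ^ n \<le> 1800 * 10 ^ n"
     "n \<ge> 2 \<Longrightarrow> 15 * 10 ^ n \<le> (int n + 1) * (int n + 2) * (int n + 3) * 9 ^ n"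
    by (fastforce dest: bspec)+
  have eq: "negbin (9 / 10) 4 n = of_int ((int n + 1) * (int n + 2) * (int n + 3) * 9 ^ n) / (6 * 10 ^ n)"
    by (simp add: negbin_4 power_divide)
  have "of_int ((int n + 1) * (int n + 2) * (int n + 3) * 9 ^ n) \<le> (of_int (1800 * 10 ^ n) :: real)"
    using *(1) by (simp only: of_int_le_iff)
  thus "negbin (9 / 10) 4 n \<le> 300" unfolding eq by (simp add: divide_simps)
  assume "n \<ge> 2"
  hence "(of_int (15 * 10 ^ n) :: real) \<le> of_int ((int n + 1) * (int n + 2) * (int n + 3) * 9 ^ n)"
    using *(2) by (simp only: of_int_le_iff)
  thus "5 / 2 \<le> negbin (9 / 10) 4 n" unfolding eq by (simp add: divide_simps)
qed

text \<open>At index m + 2 there are m + 1 summands of size M^2 rho^m, divided by (m + 1) (m + 2);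
  hence a geometric bound reproduces itself once M <= (m + 2) rho^2. The ratio 9/10 of the majorant
  would leave far too large a tail after 99 terms; a better ratio is therefore tested on the
  computed coefficients and continued from there.\<close>

lemma geometric_bound:
  assumes sol: "power_solution 0 U V" and \<rho>: "0 < \<rho>" "0 \<le> M" "M \<le> (real N + 1) * \<rho>\<^sup>2"
    and init: "\<And>n. n \<le> N \<Longrightarrow> \<bar>U n\<bar> \<le> M * \<rho> ^ n \<and> \<bar>V n\<bar> \<le> M * \<rho> ^ n" and "N \<ge> 1"
  shows "\<bar>U n\<bar> \<le> M * \<rho> ^ n \<and> \<bar>V n\<bar> \<le> M * \<rho> ^ n"
proof (induction n rule: less_induct)
  case (less n)
  show ?case
  proof (cases "n \<le> N")
    case False
    hence "n = (n - 2) + 2" using \<open>N \<ge> 1\<close> by linarith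
    then obtain m where m: "n = m + 2" by blast
    have IH: "\<bar>U k\<bar> \<le> M * \<rho> ^ k" "\<bar>V k\<bar> \<le> M * \<rho> ^ k" if "k \<le> m" for k
      using less[of k] that m by auto
    have c: "\<bar>conv f g m\<bar> \<le> (real m + 1) * (real m + 2) * (M * \<rho> ^ (m + 2))"
      if "\<And>k. k \<le> m \<Longrightarrow> \<bar>f k\<bar> \<le> M * \<rho> ^ k" "\<And>k. k \<le> m \<Longrightarrow> \<bar>g k\<bar> \<le> M * \<rho> ^ k" for f g
    proof -
      have "\<bar>conv f g m\<bar> \<le> (\<Sum>k\<le>m. \<bar>f k\<bar> * \<bar>g (m - k)\<bar>)"
        unfolding conv_def using sum_abs[of "\<lambda>k. f k * g (m - k)"] by (simp add: abs_mult)
      also have "\<dots> \<le> (\<Sum>k\<le>m. (M * \<rho> ^ k) * (M * \<rho> ^ (m - k)))"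
        using \<rho> by (intro sum_mono mult_mono that) auto
      also have "\<dots> = (\<Sum>k\<le>m. M * M * \<rho> ^ m)"
        by (intro sum.cong refl) (auto simp flip: power_add)
      also have "\<dots> = (real m + 1) * M * \<rho> ^ m * M" by simp
      also have "\<dots> \<le> (real m + 1) * M * \<rho> ^ m * ((real m + 2) * \<rho>\<^sup>2)"
      proof (intro mult_left_mono)
        have "real N + 1 \<le> real m + 2" using False m by simp
        hence "(real N + 1) * \<rho>\<^sup>2 \<le> (real m + 2) * \<rho>\<^sup>2" by (intro mult_right_mono) auto
        thus "M \<le> (real m + 2) * \<rho>\<^sup>2" using \<rho>(3) by linarith
      qed (use \<rho> in auto)
      also have "\<dots> = (real m + 1) * (real m + 2) * (M * \<rho> ^ (m + 2))"
        by (simp add: power2_eq_square)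
      finally show ?thesis .
    qed
    have "\<bar>(real m + 1) * (real m + 2) * U (m + 2)\<bar> \<le> (real m + 1) * (real m + 2) * (M * \<rho> ^ (m + 2))"
      "\<bar>(real m + 1) * (real m + 2) * V (m + 2)\<bar> \<le> (real m + 1) * (real m + 2) * (M * \<rho> ^ (m + 2))"
      unfolding power_solutionD[OF sol] using c[of V "alt U"] c[of U U] IH by auto
    thus ?thesis unfolding m abs_scaled by (blast dest: scaled_le_imp_le)
  qed (use init in auto)
qed

lemma negbin_one: "negbin r 1 n = r ^ n"
  by (simp add: negbin_def pochhammer_fact[symmetric])

lemma negbin_2: "negbin r 2 n = (real n + 1) * r ^ n"
proof (induction n)
  case (Suc n)
  have "(real n + 1) * negbin r 2 (Suc n) = (2 + real n) * r * negbin r 2 n"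
    by (simp add: negbin_def pochhammer_Suc divide_simps)
  also have "\<dots> = (real n + 1) * ((real n + 2) * r ^ Suc n)"
    unfolding Suc.IH by (simp add: algebra_simps)
  finally have "negbin r 2 (Suc n) = (real n + 2) * r ^ Suc n"
    by (subst (asm) mult_left_cancel) linarith+
  thus ?case by (simp add: add_ac)
qed simp

lemma norm_power_sum_diff_le:
  assumes "summable (\<lambda>n. of_real (c n) * z ^ n)" "summable (\<lambda>n. of_real (c' n) * z ^ n)"
    and "\<And>n. \<bar>c n - c' n\<bar> \<le> e n" "e sums s" "norm z \<le> 1"
  shows "norm (power_sum c z - power_sum c' z) \<le> s"
proof (rule norm_sums_le)
  show "(\<lambda>n. of_real (c n) * z ^ n - of_real (c' n) * z ^ n) sums (power_sum c z - power_sum c' z)"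
    unfolding power_sum_def by (intro sums_diff summable_sums assms)
  show "norm (of_real (c n) * z ^ n - of_real (c' n) * z ^ n) \<le> e n" for n
  proof -
    have "norm (of_real (c n) * z ^ n - of_real (c' n) * z ^ n) = \<bar>c n - c' n\<bar> * norm z ^ n"
      unfolding left_diff_distrib[symmetric] of_real_diff[symmetric] norm_mult norm_of_real norm_power ..
    also have "\<dots> \<le> \<bar>c n - c' n\<bar> * 1"
      using assms(5) by (intro mult_left_mono power_le_one) auto
    finally show ?thesis using assms(3)[of n] by simp
  qed
qed (use assms in auto)

lemma sums_tail:
  fixes f :: "nat \<Rightarrow> real"
  assumes "(\<lambda>n. f (n + m)) sums s"
  shows "(\<lambda>n. if n < m then 0 else f n) sums s"
  using assms sums_iff_shift[of "\<lambda>n. if n < m then 0 else f n" m s] by simp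

text \<open>Floor division errs by at most one unit, which the recursion multiplies by (n + 1) (n +
  2).\<close>

lemma rounded_coef_defect:
  fixes S :: int and a b :: "int \<times> int"
  assumes "S > 0"
  defines "A \<equiv> \<lambda>n. real_of_int (fst (rounded_coef S a b n)) / of_int S"
    and "B \<equiv> \<lambda>n. real_of_int (snd (rounded_coef S a b n)) / of_int S"
  shows "\<bar>(real n + 1) * (real n + 2) * A (n + 2) - conv B (alt A) n\<bar> \<le> (real n + 1) * (real n + 2) / of_int S"
    and "\<bar>(real n + 1) * (real n + 2) * B (n + 2) - conv A A n\<bar> \<le> (real n + 1) * (real n + 2) / of_int S"
proof -
  have main: "\<bar>(real n + 1) * (real n + 2) * (of_int (X div ((int n + 1) * (int n + 2) * S)) / of_int S)
      - of_int X / (of_int S)\<^sup>2\<bar> \<le> (real n + 1) * (real n + 2) / of_int S" for X :: int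
  proof -
    define d where "d = (int n + 1) * (int n + 2)"
    have d: "real_of_int d = (real n + 1) * (real n + 2)" "d > 0" by (simp_all add: d_def)
    have S: "real_of_int S > 0" using \<open>S > 0\<close> by simp
    have "\<bar>of_int (X div (d * S)) - of_int X / real_of_int (d * S)\<bar> \<le> 1"
      using real_of_int_div2[of X "d * S"] real_of_int_div3[of X "d * S"] by simp
    hence "real_of_int d / of_int S * \<bar>of_int (X div (d * S)) - of_int X / real_of_int (d * S)\<bar>
        \<le> real_of_int d / of_int S * 1"
      using d S by (intro mult_left_mono) auto
    moreover have eq: "real_of_int d * (of_int (X div (d * S)) / of_int S) - of_int X / (of_int S)\<^sup>2
        = real_of_int d / of_int S * (of_int (X div (d * S)) - of_int X / real_of_int (d * S))"
      using d(2) S by (simp add: field_simps power2_eq_square)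
    have "\<bar>real_of_int d * (of_int (X div (d * S)) / of_int S) - of_int X / (of_int S)\<^sup>2\<bar>
        = real_of_int d / of_int S * \<bar>of_int (X div (d * S)) - of_int X / real_of_int (d * S)\<bar>"
      unfolding eq using d(2) S by (simp add: abs_mult)
    ultimately show ?thesis unfolding d_def[symmetric] d(1)[symmetric] by simp
  qed
  have "conv B (alt A) n = of_int (\<Sum>k\<le>n. snd (rounded_coef S a b k) * ((-1) ^ (n - k) * fst (rounded_coef S a b (n - k)))) / (of_int S)\<^sup>2"
    "conv A A n = of_int (\<Sum>k\<le>n. fst (rounded_coef S a b k) * fst (rounded_coef S a b (n - k))) / (of_int S)\<^sup>2"
    by (simp_all add: conv_def alt_def A_def B_def sum_divide_distrib power2_eq_square)
  thus "\<bar>(real n + 1) * (real n + 2) * A (n + 2) - conv B (alt A) n\<bar> \<le> (real n + 1) * (real n + 2) / of_int S"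
    "\<bar>(real n + 1) * (real n + 2) * B (n + 2) - conv A A n\<bar> \<le> (real n + 1) * (real n + 2) / of_int S"
    using main by (simp_all add: A_def B_def del: of_int_sum)
qed

lemma near_norm_le:
  assumes "near p v"
  shows "norm (Complex (of_int (fst p)) (of_int (snd p)) / 10 ^ 13 - Complex (of_int (fst v)) (of_int (snd v)) / 10 ^ 13) \<le> 1 / 10 ^ 9"
proof -
  have "\<bar>fst p - fst v\<bar> \<le> 5000" "\<bar>snd p - snd v\<bar> \<le> 5000"
    using assms by (cases p; cases v; simp)+
  hence "real_of_int \<bar>fst p - fst v\<bar> \<le> real_of_int 5000" "real_of_int \<bar>snd p - snd v\<bar> \<le> real_of_int 5000"
    by (simp_all only: of_int_le_iff)
  moreover have "norm (Complex (of_int (fst p)) (of_int (snd p)) - Complex (of_int (fst v)) (of_int (snd v)))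
      \<le> \<bar>real_of_int (fst p) - of_int (fst v)\<bar> + \<bar>real_of_int (snd p) - of_int (snd v)\<bar>"
    using cmod_le by (rule order_trans) simp
  ultimately have "norm (Complex (of_int (fst p)) (of_int (snd p)) - Complex (of_int (fst v)) (of_int (snd v))) \<le> 10000"
    by simp
  thus ?thesis by (simp add: norm_divide flip: diff_divide_distrib)
qed

text \<open>The error has three sources: propagated rounding, the tail beyond index 98, and the
  tolerance of \<open>near\<close>. The sum weighted with n is z times the derivative in z; at z = i
  this is v'(1).\<close>

lemma verified_sound:
  assumes ver: "verified a b v w" and sol: "power_solution 0 U V"
    and init: "U 0 = of_int (fst a) / 10 ^ 13" "V 0 = of_int (snd a) / 10 ^ 13"
      "U 1 = of_int (fst b) / 10 ^ 13" "V 1 = of_int (snd b) / 10 ^ 13"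
    and bd: "\<And>n. \<bar>U n\<bar> \<le> 6 * (9 / 10)\<^sup>2 * negbin (9 / 10) 2 n" "\<And>n. \<bar>V n\<bar> \<le> 6 * (9 / 10)\<^sup>2 * negbin (9 / 10) 2 n"
  shows "norm (power_sum V \<i> - Complex (of_int (fst v)) (of_int (snd v)) / 10 ^ 13) \<le> 1 / 10 ^ 7"
    and "norm (power_sum (\<lambda>n. real n * V n) \<i> - Complex (of_int (fst w)) (of_int (snd w)) / 10 ^ 13) \<le> 1 / 10 ^ 7"
proof -
  let ?r = "9 / 10 :: real" and ?\<rho> = "19 / 25 :: real"
  define A B where "A = (\<lambda>n. fst (rounded_coef (10 ^ 13) a b n))" and "B = (\<lambda>n. snd (rounded_coef (10 ^ 13) a b n))"
  define U' V' where "U' = (\<lambda>n. real_of_int (A n) / 10 ^ 13)" and "V' = (\<lambda>n. real_of_int (B n) / 10 ^ 13)"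
  have run: "run 97 0 (10 ^ 13) (fst b) (snd b) [fst a] [snd a] = (map A [0..<99], map B [0..<99])"
  proof -
    have "rev [0..<Suc 0] = [0]" by simp
    from run_eq[of 97 0 "10 ^ 13" a b, unfolded this] show ?thesis by (simp add: A_def B_def del: upt_Suc)
  qed
  note ver' = ver[unfolded verified_def run prod.case]
  have geo: "\<bar>U' n\<bar> + 300 / 10 ^ 13 \<le> 55 * ?\<rho> ^ n" "\<bar>V' n\<bar> + 300 / 10 ^ 13 \<le> 55 * ?\<rho> ^ n" if "n \<le> 98" for n
    using geometric_ok_bound[of "55 * 10 ^ 13" "map A [0..<99]" n] geometric_ok_bound[of "55 * 10 ^ 13" "map B [0..<99]" n]
      ver' that by (simp_all add: U'_def V'_def divide_simps del: upt_Suc)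
  have maj: "\<bar>U' n\<bar> \<le> 6 * ?r\<^sup>2 * negbin ?r 2 n" "\<bar>V' n\<bar> \<le> 6 * ?r\<^sup>2 * negbin ?r 2 n" if "n \<le> 98" for n
    using majorant_ok_bound[of 1 "486 * 10 ^ 11" "map A [0..<99]" n] majorant_ok_bound[of 1 "486 * 10 ^ 11" "map B [0..<99]" n]
      ver' that by (simp_all add: U'_def V'_def divide_simps negbin_2 power2_eq_square add_ac mult_ac del: upt_Suc)
  have small: "(real n + 1) * (real n + 2) / 10 ^ 13 \<le> 1 / 10 ^ 13 * (4 * (4 + 1) - 12) * ?r\<^sup>2 * negbin ?r (4 + 2) n"
    if "n + 2 \<le> 98" for n
  proof -
    have "(real n + 1) * (real n + 2) * (5 / 2) \<le> (real n + 1) * (real n + 2) * negbin ?r 4 (n + 2)"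
      using that by (intro mult_left_mono negbin_4_range) auto
    thus ?thesis unfolding negbin_Suc_Suc by simp
  qed
  have diff: "\<bar>U n - U' n\<bar> \<le> 1 / 10 ^ 13 * negbin ?r 4 n \<and> \<bar>V n - V' n\<bar> \<le> 1 / 10 ^ 13 * negbin ?r 4 n" if "n \<le> 98" for n
  proof (rule difference_bound[where N = 98])
    fix n :: nat assume n: "n + 2 \<le> 98"
    have "(real n + 1) * (real n + 2) * (U (n + 2) - U' (n + 2)) - (conv V (alt U) n - conv V' (alt U') n)
        = - ((real n + 1) * (real n + 2) * U' (n + 2) - conv V' (alt U') n)"
      using power_solutionD(1)[OF sol, of n] by (simp only: right_diff_distrib)
    with rounded_coef_defect(1)[of "10 ^ 13" n a b] small[OF n]
    show "\<bar>(real n + 1) * (real n + 2) * (U (n + 2) - U' (n + 2)) - (conv V (alt U) n - conv V' (alt U') n)\<bar>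
        \<le> 1 / 10 ^ 13 * (4 * (4 + 1) - 12) * ?r\<^sup>2 * negbin ?r (4 + 2) n"
      by (simp only: abs_minus_cancel U'_def V'_def A_def B_def) simp
    have "(real n + 1) * (real n + 2) * (V (n + 2) - V' (n + 2)) - (conv U U n - conv U' U' n)
        = - ((real n + 1) * (real n + 2) * V' (n + 2) - conv U' U' n)"
      using power_solutionD(2)[OF sol, of n] by (simp only: right_diff_distrib)
    with rounded_coef_defect(2)[of "10 ^ 13" n a b] small[OF n]
    show "\<bar>(real n + 1) * (real n + 2) * (V (n + 2) - V' (n + 2)) - (conv U U n - conv U' U' n)\<bar>
        \<le> 1 / 10 ^ 13 * (4 * (4 + 1) - 12) * ?r\<^sup>2 * negbin ?r (4 + 2) n"
      by (simp only: abs_minus_cancel U'_def V'_def A_def B_def) simp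
  qed (use that bd maj init in \<open>auto simp: U'_def V'_def A_def B_def\<close>)
  \<comment> \<open>The margin 300 transfers the geometric bound from the rounded to the exact
    coefficients.\<close>
  have geo_le: "\<bar>U n\<bar> \<le> 55 * ?\<rho> ^ n \<and> \<bar>V n\<bar> \<le> 55 * ?\<rho> ^ n" if "n \<le> 98" for n
  proof -
    have "1 / 10 ^ 13 * negbin ?r 4 n \<le> 300 / 10 ^ 13"
      using negbin_4_range(1)[OF that] by (simp add: divide_right_mono)
    thus ?thesis using conjunct1[OF diff[OF that]] conjunct2[OF diff[OF that]] geo[OF that]
      by (intro conjI) linarith+
  qed
  \<comment> \<open>The bound continues to all n because 55 <= 99 * (19/25)^2, which is about
    57.2.\<close>
  have tail: "\<bar>V n\<bar> \<le> 55 * ?\<rho> ^ n" for n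
    by (rule conjunct2[OF geometric_bound[OF sol _ _ _ geo_le]]) (auto simp: power2_eq_square)
  define V'' where "V'' = (\<lambda>n. if n < 99 then V' n else 0)"
  define e where "e = (\<lambda>n. 1 / 10 ^ 13 * negbin ?r 4 n + (if n < 99 then 0 else 55 * ?\<rho> ^ n))"
  have Ve: "\<bar>V n - V'' n\<bar> \<le> e n" for n
    using diff[of n] tail[of n] negbin_nonneg[of ?r 4 n] by (auto simp: V''_def e_def)
  have geom: "(\<lambda>n. ?\<rho> ^ n) sums (25 / 6)" using geometric_sums[of ?\<rho>] by simp
  have geom': "(\<lambda>n. real n * ?\<rho> ^ n) sums (?\<rho> * (25 / 6)\<^sup>2)"
    using sums_nat_negbin[of ?\<rho> 1] by (simp add: negbin_one powr_minus powr_numeral power2_eq_square)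
  have p99: "?\<rho> ^ 99 \<le> 16 / 10 ^ 13" by (simp add: power_divide divide_simps)
  have nb: "negbin ?r 4 sums (10 ^ 4)"
    using sums_negbin[of ?r 4] by (simp add: powr_minus powr_numeral power_divide)
  have nb': "(\<lambda>n. real n * negbin ?r 4 n) sums (4 * ?r * 10 ^ 5)"
    using sums_nat_negbin[of ?r 4] by (simp add: powr_minus powr_numeral power_divide)
  have "(\<lambda>n. 55 * ?\<rho> ^ (n + 99)) sums (55 * ?\<rho> ^ 99 * (25 / 6))"
    using sums_mult[OF geom, of "55 * ?\<rho> ^ 99"] by (simp add: power_add mult_ac)
  hence "e sums (1 / 10 ^ 13 * 10 ^ 4 + 55 * ?\<rho> ^ 99 * (25 / 6))"
    unfolding e_def by (intro sums_add sums_mult sums_tail nb)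
  have "(\<lambda>n. real (n + 99) * (55 * ?\<rho> ^ (n + 99))) sums (55 * ?\<rho> ^ 99 * (?\<rho> * (25 / 6)\<^sup>2 + 99 * (25 / 6)))"
    using sums_mult[OF sums_add[OF geom' sums_mult[OF geom, of 99]], of "55 * ?\<rho> ^ 99"]
    by (simp add: power_add algebra_simps)
  hence "(\<lambda>n. 1 / 10 ^ 13 * (real n * negbin ?r 4 n) + (if n < 99 then 0 else real n * (55 * ?\<rho> ^ n)))
      sums (1 / 10 ^ 13 * (4 * ?r * 10 ^ 5) + 55 * ?\<rho> ^ 99 * (?\<rho> * (25 / 6)\<^sup>2 + 99 * (25 / 6)))"
    by (intro sums_add sums_mult sums_tail nb')
  moreover have "real n * e n = 1 / 10 ^ 13 * (real n * negbin ?r 4 n) + (if n < 99 then 0 else real n * (55 * ?\<rho> ^ n))" for n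
    by (simp add: e_def algebra_simps)
  ultimately have esum': "(\<lambda>n. real n * e n) sums (1 / 10 ^ 13 * (4 * ?r * 10 ^ 5) + 55 * ?\<rho> ^ 99 * (?\<rho> * (25 / 6)\<^sup>2 + 99 * (25 / 6)))"
    by simp
  have fin: "power_sum c \<i> = (\<Sum>n<99. of_real (c n) * \<i> ^ n)" "summable (\<lambda>n. of_real (c n) * \<i> ^ n)"
    if "\<And>n. \<not> n < 99 \<Longrightarrow> c n = 0" for c
  proof -
    have 0: "of_real (c n) * \<i> ^ n = 0" if "n \<notin> {..<99}" for n
      using \<open>\<And>n. \<not> n < 99 \<Longrightarrow> c n = 0\<close> that by simp
    show "power_sum c \<i> = (\<Sum>n<99. of_real (c n) * \<i> ^ n)"
      unfolding power_sum_def using 0 by (intro suminf_finite) auto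
    show "summable (\<lambda>n. of_real (c n) * \<i> ^ n)"
      using 0 by (intro summable_finite[of "{..<99}"]) auto
  qed
  have summable: "summable (\<lambda>n. of_real (V n) * \<i> ^ n)" "summable (\<lambda>n. of_real (real n * V n) * \<i> ^ n)"
  proof -
    show "summable (\<lambda>n. of_real (V n) * \<i> ^ n)"
      by (rule summable_comparison_test'[OF summable_mult[OF sums_summable[OF geom], of 55]])
        (use tail in \<open>auto simp: norm_mult norm_power\<close>)
    show "summable (\<lambda>n. of_real (real n * V n) * \<i> ^ n)"
    proof (rule summable_comparison_test'[OF summable_mult[OF sums_summable[OF geom'], of 55]])
      show "norm (of_real (real n * V n) * \<i> ^ n) \<le> 55 * (real n * ?\<rho> ^ n)" for n
        using mult_left_mono[OF tail[of n], of "real n"] by (simp add: norm_mult norm_power mult_ac)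
    qed
  qed
  have "norm (power_sum V \<i> - power_sum V'' \<i>) \<le> 1 / 10 ^ 13 * 10 ^ 4 + 55 * ?\<rho> ^ 99 * (25 / 6)"
    by (rule norm_power_sum_diff_le[OF summable(1) fin(2) Ve \<open>e sums _\<close>]) (auto simp: V''_def)
  moreover have "power_sum V'' \<i> = Complex (of_int (fst (at_ii (map B [0..<99])))) (of_int (snd (at_ii (map B [0..<99])))) / 10 ^ 13"
    unfolding at_ii_eq_sum sum_divide_distrib
    by (subst fin) (auto simp: V''_def V'_def simp del: upt_Suc sum.lessThan_Suc intro!: sum.cong)
  moreover have "1 / 10 ^ 13 * 10 ^ 4 + 55 * ?\<rho> ^ 99 * (25 / 6) \<le> (9 / 10 ^ 8 :: real)"
    using p99 by simp
  ultimately have n1: "norm (power_sum V \<i> - Complex (of_int (fst (at_ii (map B [0..<99])))) (of_int (snd (at_ii (map B [0..<99])))) / 10 ^ 13) \<le> 9 / 10 ^ 8"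
    by simp
  have "norm (power_sum (\<lambda>n. real n * V n) \<i> - power_sum (\<lambda>n. real n * V'' n) \<i>)
      \<le> 1 / 10 ^ 13 * (4 * ?r * 10 ^ 5) + 55 * ?\<rho> ^ 99 * (?\<rho> * (25 / 6)\<^sup>2 + 99 * (25 / 6))"
  proof (rule norm_power_sum_diff_le[OF summable(2) fin(2) _ esum'])
    show "\<bar>real n * V n - real n * V'' n\<bar> \<le> real n * e n" for n
      using mult_left_mono[OF Ve[of n], of "real n"] by (simp add: abs_mult flip: right_diff_distrib)
  qed (auto simp: V''_def)
  moreover have "power_sum (\<lambda>n. real n * V'' n) \<i>
      = Complex (of_int (fst (at_ii (weighted 0 (map B [0..<99]))))) (of_int (snd (at_ii (weighted 0 (map B [0..<99]))))) / 10 ^ 13"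
    unfolding at_ii_eq_sum sum_divide_distrib
    by (subst fin) (auto simp: V''_def V'_def nth_weighted simp del: upt_Suc sum.lessThan_Suc intro!: sum.cong)
  \<comment> \<open>Rounding contributes 3.6 * 10^-8 and the tail less than 3.8 * 10^-8.\<close>
  moreover have "1 / 10 ^ 13 * (4 * ?r * 10 ^ 5) + 55 * ?\<rho> ^ 99 * (?\<rho> * (25 / 6)\<^sup>2 + 99 * (25 / 6)) \<le> (9 / 10 ^ 8 :: real)"
    using p99 by (simp add: power2_eq_square)
  ultimately have n2: "norm (power_sum (\<lambda>n. real n * V n) \<i>
      - Complex (of_int (fst (at_ii (weighted 0 (map B [0..<99]))))) (of_int (snd (at_ii (weighted 0 (map B [0..<99]))))) / 10 ^ 13) \<le> 9 / 10 ^ 8"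
    by simp
  have tri: "norm (x - z) \<le> 1 / 10 ^ 7" if "norm (x - y) \<le> 9 / 10 ^ 8" "norm (y - z) \<le> 1 / 10 ^ 9" for x y z :: complex
    using norm_triangle_ineq[of "x - y" "y - z"] that by simp
  show "norm (power_sum V \<i> - Complex (of_int (fst v)) (of_int (snd v)) / 10 ^ 13) \<le> 1 / 10 ^ 7"
    using ver' by (intro tri[OF n1] near_norm_le) simp
  show "norm (power_sum (\<lambda>n. real n * V n) \<i> - Complex (of_int (fst w)) (of_int (snd w)) / 10 ^ 13) \<le> 1 / 10 ^ 7"
    using ver' by (intro tri[OF n2] near_norm_le) simp
qed

section \<open>Existence of a clamped solution\<close>

text \<open>The parameters come from a numerical Newton iteration: up to an error of about \<open>10\<^bsup>-9\<^esup>\<close>, the pair \<open>(v(1), v'(1))\<close>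
  takes the values \<open>(0, 0)\<close>, \<open>(h, 0)\<close>, \<open>(\<i>h, 0)\<close>, \<open>(0, h)\<close>, \<open>(0, \<i>h)\<close> at the five vertices, where
  \<open>h = 3/2 \<sqdot> 10\<^bsup>-6\<^esup>\<close>. All integers are to be divided by \<open>10\<^bsup>13\<^esup>\<close>.\<close>

definition vertex_a :: "nat \<Rightarrow> int \<times> int" where
  "vertex_a = (!) [(48394505172606, 46783475887488), (48394495199295, 46783473685257),
     (48394499962721, 46783467140863), (48394507057099, 46783475741655), (48394509035328, 46783481626524)]"

definition vertex_b :: "nat \<Rightarrow> int \<times> int" where
  "vertex_b = (!) [(46366026034590, 34853419472151), (46366011761368, 34853403168935),
     (46366028886714, 34853436476106), (46366032846067, 34853425734727), (46366027404788, 34853419338093)]"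

definition vertex_value :: "nat \<Rightarrow> int \<times> int" where
  "vertex_value = (!) [(0, 0), (15000000, 0), (0, 15000000), (0, 0), (0, 0)]"

definition vertex_slope :: "nat \<Rightarrow> int \<times> int" where
  "vertex_slope = (!) [(0, 0), (0, 0), (0, 0), (15000000, 0), (0, 15000000)]"

lemma verified_vertex_0: "verified (vertex_a 0) (vertex_b 0) (vertex_value 0) (vertex_slope 0)"
  by code_simp

lemma verified_vertex_1: "verified (vertex_a 1) (vertex_b 1) (vertex_value 1) (vertex_slope 1)"
  by code_simp

lemma verified_vertex_2: "verified (vertex_a 2) (vertex_b 2) (vertex_value 2) (vertex_slope 2)"
  by code_simp

lemma verified_vertex_3: "verified (vertex_a 3) (vertex_b 3) (vertex_value 3) (vertex_slope 3)"
  by code_simp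

lemma verified_vertex_4: "verified (vertex_a 4) (vertex_b 4) (vertex_value 4) (vertex_slope 4)"
  by code_simp

section \<open>Affine coordinates for the initial data\<close>

definition scaled :: "int \<times> int \<Rightarrow> real \<times> real" where
  "scaled p = (of_int (fst p) / 10 ^ 13, of_int (snd p) / 10 ^ 13)"

text \<open>The four real coordinates are packed into C^2 because (v(1), v'(1)) lies there:
  parameters and boundary values can then be compared directly, on a product of two unit
  discs.\<close>

definition component :: "complex \<times> complex \<Rightarrow> nat \<Rightarrow> real" where
  "component s = (!) [Re (fst s), Im (fst s), Re (snd s), Im (snd s)]"

text \<open>Vertex 0 has coordinates s = 0 and the other vertices are the four unit vectors. As s
  runs through a product of discs, points outside the simplex occur as well.\<close>

definition mix :: "(nat \<Rightarrow> int \<times> int) \<Rightarrow> complex \<times> complex \<Rightarrow> real \<times> real" where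
  "mix f s = scaled (f 0) + (\<Sum>j<4. component s j *\<^sub>R (scaled (f (Suc j)) - scaled (f 0)))"

lemma sum_4: "(\<Sum>j<4. f j) = f 0 + f 1 + f 2 + f (3 :: nat)"
  by (simp add: eval_nat_numeral)

lemma less_4_cases: "j < 4 \<Longrightarrow> (j = 0 \<Longrightarrow> P) \<Longrightarrow> (j = 1 \<Longrightarrow> P) \<Longrightarrow> (j = 2 \<Longrightarrow> P) \<Longrightarrow> (j = 3 \<Longrightarrow> P) \<Longrightarrow> P" for j :: nat
  by linarith

lemma component_simps [simp]:
  "component s 0 = Re (fst s)" "component s (Suc 0) = Im (fst s)"
  "component s 2 = Re (snd s)" "component s 3 = Im (snd s)"
  by (simp_all add: component_def eval_nat_numeral)

text \<open>Each disc contributes at most sqrt 2, rounded up to 3/2.\<close>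

lemma sum_abs_component_le:
  assumes "norm (fst s) \<le> 1" "norm (snd s) \<le> 1"
  shows "(\<Sum>j<4. \<bar>component s j\<bar>) \<le> 3"
proof -
  have "\<bar>Re z\<bar> + \<bar>Im z\<bar> \<le> 3 / 2" if "norm z \<le> 1" for z
  proof -
    have "sqrt 2 * norm z \<le> sqrt 2 * 1" using that by (intro mult_left_mono) auto
    moreover have "sqrt 2 \<le> (3 / 2 :: real)" by (rule real_le_lsqrt) (auto simp: power2_eq_square)
    ultimately show ?thesis using complex_abs_le_norm[of z] by linarith
  qed
  from this[OF assms(1)] this[OF assms(2)] show ?thesis by (simp add: sum_4)
qed

text \<open>The two bounds are kappa and 3 r kappa for kappa = 10^-6 and r = 9/10, as the initial
  conditions of \<open>lipschitz_bound\<close> demand.\<close>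

lemma vertex_bounds:
  assumes "j < 4"
  shows "\<bar>fst (scaled (vertex_a (Suc j))) - fst (scaled (vertex_a 0))\<bar> \<le> 1 / 10 ^ 6"
    "\<bar>snd (scaled (vertex_a (Suc j))) - snd (scaled (vertex_a 0))\<bar> \<le> 1 / 10 ^ 6"
    "\<bar>fst (scaled (vertex_b (Suc j))) - fst (scaled (vertex_b 0))\<bar> \<le> 27 / 10 ^ 7"
    "\<bar>snd (scaled (vertex_b (Suc j))) - snd (scaled (vertex_b 0))\<bar> \<le> 27 / 10 ^ 7"
  using assms by (elim less_4_cases; simp add: scaled_def vertex_a_def vertex_b_def eval_nat_numeral)+

lemma mix_diff:
  "fst (mix f s) - fst (scaled (f 0)) = (\<Sum>j<4. component s j * (fst (scaled (f (Suc j))) - fst (scaled (f 0))))"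
  "snd (mix f s) - snd (scaled (f 0)) = (\<Sum>j<4. component s j * (snd (scaled (f (Suc j))) - snd (scaled (f 0))))"
  by (simp_all add: mix_def fst_sum snd_sum)

lemma abs_sum_component_le:
  assumes "norm (fst s) \<le> 1" "norm (snd s) \<le> 1" "\<And>j. j < 4 \<Longrightarrow> \<bar>x j\<bar> \<le> d" "0 \<le> d"
  shows "\<bar>\<Sum>j<4. component s j * x j\<bar> \<le> 3 * d"
proof -
  have "\<bar>\<Sum>j<4. component s j * x j\<bar> \<le> (\<Sum>j<4. \<bar>component s j\<bar> * d)"
    by (rule order_trans[OF sum_abs sum_mono]) (auto simp: abs_mult intro!: mult_left_mono assms)
  also have "\<dots> = (\<Sum>j<4. \<bar>component s j\<bar>) * d" by (simp add: sum_distrib_right)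
  also have "\<dots> \<le> 3 * d" by (intro mult_right_mono sum_abs_component_le assms)
  finally show ?thesis .
qed

lemma summable_at_ii:
  assumes "\<And>n. \<bar>c n\<bar> \<le> M * negbin r p n" "0 \<le> r" "r < 1"
  shows "summable (\<lambda>n. of_real (c n) * \<i> ^ n)" "summable (\<lambda>n. of_real (real n * c n) * \<i> ^ n)"
proof -
  show "summable (\<lambda>n. of_real (c n) * \<i> ^ n)"
    by (rule summable_comparison_test'[OF summable_mult[OF sums_summable[OF sums_negbin[OF assms(2,3)]]]])
      (use assms(1) in \<open>auto simp: norm_mult norm_power\<close>)
  show "summable (\<lambda>n. of_real (real n * c n) * \<i> ^ n)"
  proof (rule summable_comparison_test'[OF summable_mult[OF sums_summable[OF sums_nat_negbin[OF assms(2,3)]]]])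
    show "norm (of_real (real n * c n) * \<i> ^ n) \<le> M * (real n * negbin r p n)" for n
      using mult_left_mono[OF assms(1)[of n], of "real n"] by (simp add: norm_mult norm_power mult_ac)
  qed
qed

lemma power_sum_affine:
  assumes "summable (\<lambda>n. of_real (c0 n) * z ^ n)" "\<And>j. j \<in> J \<Longrightarrow> summable (\<lambda>n. of_real (c j n) * z ^ n)"
  shows "(\<lambda>n. of_real (c0 n + (\<Sum>j\<in>J. s j * (c j n - c0 n))) * z ^ n) sums
    (power_sum c0 z + (\<Sum>j\<in>J. of_real (s j) * (power_sum (c j) z - power_sum c0 z)))"
proof -
  have "(\<lambda>n. of_real (c0 n) * z ^ n + (\<Sum>j\<in>J. of_real (s j) * (of_real (c j n) * z ^ n - of_real (c0 n) * z ^ n)))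
      sums (power_sum c0 z + (\<Sum>j\<in>J. of_real (s j) * (power_sum (c j) z - power_sum c0 z)))"
    unfolding power_sum_def
    by (intro sums_add sums_sum sums_mult sums_diff summable_sums assms)
  moreover have "of_real (c0 n) * z ^ n + (\<Sum>j\<in>J. of_real (s j) * (of_real (c j n) * z ^ n - of_real (c0 n) * z ^ n))
      = of_real (c0 n + (\<Sum>j\<in>J. s j * (c j n - c0 n))) * z ^ n" for n
    by (simp add: algebra_simps sum_distrib_left sum_distrib_right flip: sum_subtractf)
  ultimately show ?thesis by simp
qed

lemma at_ii_error:
  assumes "summable (\<lambda>n. of_real (c n) * \<i> ^ n)" "summable (\<lambda>n. of_real (c' n) * \<i> ^ n)"
    and "summable (\<lambda>n. of_real (real n * c n) * \<i> ^ n)" "summable (\<lambda>n. of_real (real n * c' n) * \<i> ^ n)"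
    and "\<And>n. \<bar>c n - c' n\<bar> \<le> \<kappa> * negbin (9 / 10) 4 n"
  shows "norm (power_sum c \<i> - power_sum c' \<i>) \<le> \<kappa> * 10 ^ 4"
    and "norm (power_sum (\<lambda>n. real n * c n) \<i> - power_sum (\<lambda>n. real n * c' n) \<i>) \<le> \<kappa> * 360000"
proof -
  have "negbin (9 / 10) 4 sums (10 ^ 4)"
    using sums_negbin[of "9 / 10" 4] by (simp add: powr_minus powr_numeral power_divide)
  from norm_power_sum_diff_le[OF assms(1,2,5) sums_mult[OF this]]
  show "norm (power_sum c \<i> - power_sum c' \<i>) \<le> \<kappa> * 10 ^ 4" by simp
  have s: "(\<lambda>n. real n * negbin (9 / 10) 4 n) sums 360000"
    using sums_nat_negbin[of "9 / 10" 4] by (simp add: powr_minus powr_numeral power_divide)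
  have "\<bar>real n * c n - real n * c' n\<bar> \<le> \<kappa> * (real n * negbin (9 / 10) 4 n)" for n
    using mult_left_mono[OF assms(5)[of n], of "real n"]
    by (simp add: abs_mult mult_ac flip: right_diff_distrib)
  from norm_power_sum_diff_le[OF assms(3,4) this sums_mult[OF s]]
  show "norm (power_sum (\<lambda>n. real n * c n) \<i> - power_sum (\<lambda>n. real n * c' n) \<i>) \<le> \<kappa> * 360000" by simp
qed

lemma mix_bounds:
  assumes "norm (fst s) \<le> 1" "norm (snd s) \<le> 1"
  shows "\<bar>fst (mix vertex_a s) - fst (scaled (vertex_a 0))\<bar> \<le> 3 / 10 ^ 6"
    "\<bar>snd (mix vertex_a s) - snd (scaled (vertex_a 0))\<bar> \<le> 3 / 10 ^ 6"
    "\<bar>fst (mix vertex_b s) - fst (scaled (vertex_b 0))\<bar> \<le> 81 / 10 ^ 7"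
    "\<bar>snd (mix vertex_b s) - snd (scaled (vertex_b 0))\<bar> \<le> 81 / 10 ^ 7"
  unfolding mix_diff
  using abs_sum_component_le[OF assms, of _ "1 / 10 ^ 6"] abs_sum_component_le[OF assms, of _ "27 / 10 ^ 7"]
    vertex_bounds by auto

lemma center_values:
  "fst (scaled (vertex_a 0)) = 48394505172606 / 10 ^ 13" "snd (scaled (vertex_a 0)) = 46783475887488 / 10 ^ 13"
  "fst (scaled (vertex_b 0)) = 46366026034590 / 10 ^ 13" "snd (scaled (vertex_b 0)) = 34853419472151 / 10 ^ 13"
  by (simp_all add: scaled_def vertex_a_def vertex_b_def)

lemma coef_bound:
  assumes "0 \<le> \<eta>" "\<eta> \<le> 1 / 10 ^ 14"
    and "\<bar>fst p - fst (scaled (vertex_a 0))\<bar> \<le> 1 / 10 ^ 5" "\<bar>snd p - snd (scaled (vertex_a 0))\<bar> \<le> 1 / 10 ^ 5"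
      "\<bar>fst p' - fst (scaled (vertex_b 0))\<bar> \<le> 1 / 10 ^ 5" "\<bar>snd p' - snd (scaled (vertex_b 0))\<bar> \<le> 1 / 10 ^ 5"
  shows "\<bar>fst (coef \<eta> p p' n)\<bar> \<le> 6 * (9 / 10)\<^sup>2 * negbin (9 / 10) 2 n"
    and "\<bar>snd (coef \<eta> p p' n)\<bar> \<le> 6 * (9 / 10)\<^sup>2 * negbin (9 / 10) 2 n"
proof -
  \<comment> \<open>6 mu r^2 is about 4.855, still above the largest initial value, about 4.8395;
    and mu (1 - mu), about 10^-3, leaves ample room for 4 eta.\<close>
  let ?\<mu> = "999 / 1000 :: real"
  have init: "\<bar>fst p\<bar> \<le> 485 / 100" "\<bar>snd p\<bar> \<le> 485 / 100"
      "\<bar>fst p'\<bar> \<le> 485 / 100" "\<bar>snd p'\<bar> \<le> 485 / 100"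
    using assms(3-) unfolding center_values abs_le_iff by simp_all
  have "\<bar>fst (coef \<eta> p p' n)\<bar> \<le> 6 * ?\<mu> * (9 / 10)\<^sup>2 * negbin (9 / 10) 2 n \<and>
      \<bar>snd (coef \<eta> p p' n)\<bar> \<le> 6 * ?\<mu> * (9 / 10)\<^sup>2 * negbin (9 / 10) 2 n"
    by (rule power_solution_bound[OF _ assms(1) _ _ power_solution_coef[of \<eta> p p']])
      (use assms(2) init in \<open>auto simp: power2_eq_square power3_eq_cube\<close>)
  moreover have "6 * ?\<mu> * (9 / 10)\<^sup>2 * negbin (9 / 10) 2 n \<le> 6 * (9 / 10)\<^sup>2 * negbin (9 / 10) 2 n"
    using negbin_nonneg[of "9 / 10" 2 n] by (intro mult_right_mono) auto
  ultimately show "\<bar>fst (coef \<eta> p p' n)\<bar> \<le> 6 * (9 / 10)\<^sup>2 * negbin (9 / 10) 2 n"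
    "\<bar>snd (coef \<eta> p p' n)\<bar> \<le> 6 * (9 / 10)\<^sup>2 * negbin (9 / 10) 2 n" by auto
qed

lemma vertex_coef_bound:
  assumes "e \<le> 4"
  shows "\<bar>fst (coef 0 (scaled (vertex_a e)) (scaled (vertex_b e)) n)\<bar> \<le> 6 * (9 / 10)\<^sup>2 * negbin (9 / 10) 2 n"
    and "\<bar>snd (coef 0 (scaled (vertex_a e)) (scaled (vertex_b e)) n)\<bar> \<le> 6 * (9 / 10)\<^sup>2 * negbin (9 / 10) 2 n"
proof -
  have "1 / 10 ^ 6 \<le> (1 / 10 ^ 5 :: real)" "27 / 10 ^ 7 \<le> (1 / 10 ^ 5 :: real)" by simp_all
  hence "\<bar>fst (scaled (vertex_a e)) - fst (scaled (vertex_a 0))\<bar> \<le> 1 / 10 ^ 5 \<and>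
    \<bar>snd (scaled (vertex_a e)) - snd (scaled (vertex_a 0))\<bar> \<le> 1 / 10 ^ 5 \<and>
    \<bar>fst (scaled (vertex_b e)) - fst (scaled (vertex_b 0))\<bar> \<le> 1 / 10 ^ 5 \<and>
    \<bar>snd (scaled (vertex_b e)) - snd (scaled (vertex_b 0))\<bar> \<le> 1 / 10 ^ 5"
    using assms vertex_bounds[of "e - 1"] by (cases e) (auto intro: order_trans)
  hence *: "\<bar>fst (scaled (vertex_a e)) - fst (scaled (vertex_a 0))\<bar> \<le> 1 / 10 ^ 5"
    "\<bar>snd (scaled (vertex_a e)) - snd (scaled (vertex_a 0))\<bar> \<le> 1 / 10 ^ 5"
    "\<bar>fst (scaled (vertex_b e)) - fst (scaled (vertex_b 0))\<bar> \<le> 1 / 10 ^ 5"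
    "\<bar>snd (scaled (vertex_b e)) - snd (scaled (vertex_b 0))\<bar> \<le> 1 / 10 ^ 5"
    by blast+
  from coef_bound[OF _ _ *, of 0]
  show "\<bar>fst (coef 0 (scaled (vertex_a e)) (scaled (vertex_b e)) n)\<bar> \<le> 6 * (9 / 10)\<^sup>2 * negbin (9 / 10) 2 n"
    "\<bar>snd (coef 0 (scaled (vertex_a e)) (scaled (vertex_b e)) n)\<bar> \<le> 6 * (9 / 10)\<^sup>2 * negbin (9 / 10) 2 n" by auto
qed

lemma mix_coef_bound:
  assumes "0 \<le> \<eta>" "\<eta> \<le> 1 / 10 ^ 14" "norm (fst s) \<le> 1" "norm (snd s) \<le> 1"
  shows "\<bar>fst (coef \<eta> (mix vertex_a s) (mix vertex_b s) n)\<bar> \<le> 6 * (9 / 10)\<^sup>2 * negbin (9 / 10) 2 n"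
    and "\<bar>snd (coef \<eta> (mix vertex_a s) (mix vertex_b s) n)\<bar> \<le> 6 * (9 / 10)\<^sup>2 * negbin (9 / 10) 2 n"
  by (rule coef_bound[OF assms(1,2)];
      (rule order_trans[OF mix_bounds(1)] order_trans[OF mix_bounds(2)]
        order_trans[OF mix_bounds(3)] order_trans[OF mix_bounds(4)]; simp add: assms))+

section \<open>Dependence of the solutions on the initial data and on eta\<close>

abbreviation "vertex_U e n \<equiv> fst (coef 0 (scaled (vertex_a e)) (scaled (vertex_b e)) n)"
abbreviation "vertex_V e n \<equiv> snd (coef 0 (scaled (vertex_a e)) (scaled (vertex_b e)) n)"
abbreviation "mix_U \<eta> s n \<equiv> fst (coef \<eta> (mix vertex_a s) (mix vertex_b s) n)"
abbreviation "mix_V \<eta> s n \<equiv> snd (coef \<eta> (mix vertex_a s) (mix vertex_b s) n)"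

text \<open>The exponent 3 is exactly balanced, 3 * 4 = 12: it grants nothing to a defect, but two
  exact solutions have none.\<close>

lemma lipschitz_bound:
  assumes sol: "power_solution 0 U V" "power_solution 0 U' V'" and r: "r > 0" and \<kappa>: "\<kappa> \<ge> 0"
    and bd: "\<And>n. \<bar>U n\<bar> \<le> 6 * r\<^sup>2 * negbin r 2 n" "\<And>n. \<bar>V n\<bar> \<le> 6 * r\<^sup>2 * negbin r 2 n"
      "\<And>n. \<bar>U' n\<bar> \<le> 6 * r\<^sup>2 * negbin r 2 n" "\<And>n. \<bar>V' n\<bar> \<le> 6 * r\<^sup>2 * negbin r 2 n"
    and init: "\<bar>U 0 - U' 0\<bar> \<le> \<kappa>" "\<bar>V 0 - V' 0\<bar> \<le> \<kappa>"
      "\<bar>U 1 - U' 1\<bar> \<le> \<kappa> * 3 * r" "\<bar>V 1 - V' 1\<bar> \<le> \<kappa> * 3 * r"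
  shows "\<bar>U n - U' n\<bar> \<le> \<kappa> * negbin r 3 n" "\<bar>V n - V' n\<bar> \<le> \<kappa> * negbin r 3 n"
proof -
  have "\<bar>U n - U' n\<bar> \<le> \<kappa> * negbin r 3 n \<and> \<bar>V n - V' n\<bar> \<le> \<kappa> * negbin r 3 n"
  proof (rule difference_bound[OF r _ \<kappa> bd _ _ init order_refl])
    fix m
    show "\<bar>(real m + 1) * (real m + 2) * (U (m + 2) - U' (m + 2)) - (conv V (alt U) m - conv V' (alt U') m)\<bar>
        \<le> \<kappa> * (3 * (3 + 1) - 12) * r\<^sup>2 * negbin r (3 + 2) m"
      unfolding right_diff_distrib power_solutionD[OF sol(1)] power_solutionD[OF sol(2)] by simp
    show "\<bar>(real m + 1) * (real m + 2) * (V (m + 2) - V' (m + 2)) - (conv U U m - conv U' U' m)\<bar>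
        \<le> \<kappa> * (3 * (3 + 1) - 12) * r\<^sup>2 * negbin r (3 + 2) m"
      unfolding right_diff_distrib power_solutionD[OF sol(1)] power_solutionD[OF sol(2)] by simp
  qed simp
  thus "\<bar>U n - U' n\<bar> \<le> \<kappa> * negbin r 3 n" "\<bar>V n - V' n\<bar> \<le> \<kappa> * negbin r 3 n" by auto
qed

text \<open>The terms with eta form a defect of at most 4 eta * 6 r^2, to be paid from 8 r^2 kappa;
  this gives kappa = 3 eta.\<close>

lemma parameter_bound:
  assumes sol: "power_solution \<eta> U V" "power_solution 0 U' V'" and r: "r > 0" and \<eta>: "\<eta> \<ge> 0"
    and bd: "\<And>n. \<bar>U n\<bar> \<le> 6 * r\<^sup>2 * negbin r 2 n" "\<And>n. \<bar>V n\<bar> \<le> 6 * r\<^sup>2 * negbin r 2 n"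
      "\<And>n. \<bar>U' n\<bar> \<le> 6 * r\<^sup>2 * negbin r 2 n" "\<And>n. \<bar>V' n\<bar> \<le> 6 * r\<^sup>2 * negbin r 2 n"
    and init: "U 0 = U' 0" "V 0 = V' 0" "U 1 = U' 1" "V 1 = V' 1"
  shows "\<bar>V n - V' n\<bar> \<le> 3 * \<eta> * negbin r 4 n"
proof -
  have small: "\<bar>\<epsilon> * x\<bar> \<le> 3 * \<eta> * (4 * (4 + 1) - 12) * r\<^sup>2 * negbin r (4 + 2) m"
    if "0 \<le> \<epsilon>" "\<epsilon> \<le> 4 * \<eta>" "\<bar>x\<bar> \<le> 6 * r\<^sup>2 * negbin r 2 m" for \<epsilon> x m
  proof -
    have "\<bar>\<epsilon> * x\<bar> \<le> (4 * \<eta>) * (6 * r\<^sup>2 * negbin r 2 m)"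
      unfolding abs_mult using that \<eta> by (intro mult_mono) auto
    also have "\<dots> \<le> (4 * \<eta>) * (6 * r\<^sup>2 * negbin r 6 m)"
      using r \<eta> by (intro mult_left_mono negbin_mono) auto
    finally show ?thesis by simp
  qed
  have "\<bar>U n - U' n\<bar> \<le> 3 * \<eta> * negbin r 4 n \<and> \<bar>V n - V' n\<bar> \<le> 3 * \<eta> * negbin r 4 n"
  proof (rule difference_bound[OF r _ _ bd _ _ _ _ _ _ order_refl])
    fix m
    show "\<bar>(real m + 1) * (real m + 2) * (U (m + 2) - U' (m + 2)) - (conv V (alt U) m - conv V' (alt U') m)\<bar>
        \<le> 3 * \<eta> * (4 * (4 + 1) - 12) * r\<^sup>2 * negbin r (4 + 2) m"
      unfolding right_diff_distrib power_solutionD[OF sol(1)] power_solutionD[OF sol(2)]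
      using small[of \<eta> "U m" m] \<eta> bd by simp
    show "\<bar>(real m + 1) * (real m + 2) * (V (m + 2) - V' (m + 2)) - (conv U U m - conv U' U' m)\<bar>
        \<le> 3 * \<eta> * (4 * (4 + 1) - 12) * r\<^sup>2 * negbin r (4 + 2) m"
      unfolding right_diff_distrib power_solutionD[OF sol(1)] power_solutionD[OF sol(2)]
      using small[of "4 * \<eta>" "V m" m] \<eta> bd by simp
  qed (use init \<eta> r in auto)
  thus ?thesis by simp
qed

lemma vertex_difference:
  assumes "j < 4"
  shows "\<bar>vertex_U (Suc j) n - vertex_U 0 n\<bar> \<le> 1 / 10 ^ 6 * negbin (9 / 10) 3 n"
    "\<bar>vertex_V (Suc j) n - vertex_V 0 n\<bar> \<le> 1 / 10 ^ 6 * negbin (9 / 10) 3 n"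
  using assms vertex_bounds[OF assms]
  by (intro lipschitz_bound[OF power_solution_coef power_solution_coef] vertex_coef_bound; simp)+

lemma mix_vertex_difference:
  assumes "j < 4" "norm (fst s) \<le> 1" "norm (snd s) \<le> 1"
  shows "\<bar>mix_U 0 s n - vertex_U (Suc j) n\<bar> \<le> 4 / 10 ^ 6 * negbin (9 / 10) 3 n"
proof (rule lipschitz_bound(1)[OF power_solution_coef power_solution_coef])
  \<comment> \<open>Comparison through vertex 0: in units of 10^-6 the point is within 3 and the
    other vertex within 1, which gives 4; for the index 1 these are multiplied by 3 * 9/10.\<close>
  note b = mix_bounds[OF assms(2,3)] vertex_bounds[OF assms(1)]
  have *: "\<bar>x - z\<bar> \<le> a + b" if "\<bar>x - y\<bar> \<le> a" "\<bar>z - y\<bar> \<le> b" for x y z a b :: real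
    using that by linarith
  note b = *[OF b(1) b(5)] *[OF b(2) b(6)] *[OF b(3) b(7)] *[OF b(4) b(8)]
  from b show "\<bar>mix_U 0 s 0 - vertex_U (Suc j) 0\<bar> \<le> 4 / 10 ^ 6" "\<bar>mix_V 0 s 0 - vertex_V (Suc j) 0\<bar> \<le> 4 / 10 ^ 6"
    "\<bar>mix_U 0 s 1 - vertex_U (Suc j) 1\<bar> \<le> 4 / 10 ^ 6 * 3 * (9 / 10)"
    "\<bar>mix_V 0 s 1 - vertex_V (Suc j) 1\<bar> \<le> 4 / 10 ^ 6 * 3 * (9 / 10)"
    by simp_all
qed (use assms in \<open>auto intro!: mix_coef_bound vertex_coef_bound\<close>)

text \<open>The initial data are affine in s, so the deviation starts at zero and is driven by
  products of first differences only.\<close>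

lemma mix_second_order:
  assumes "norm (fst s) \<le> 1" "norm (snd s) \<le> 1"
  shows "\<bar>mix_V 0 s n - vertex_V 0 n - (\<Sum>j<4. component s j * (vertex_V (Suc j) n - vertex_V 0 n))\<bar>
    \<le> 19 / 10 ^ 13 * negbin (9 / 10) 4 n"
proof -
  have "(\<Sum>j<4. \<bar>component s j\<bar>) * (1 / 10 ^ 6 * (4 / 10 ^ 6)) \<le> 3 * (1 / 10 ^ 6 * (4 / 10 ^ 6))"
    by (intro mult_right_mono sum_abs_component_le assms) auto
  \<comment> \<open>3 * 10^-6 * 4 * 10^-6 = 1.2 * 10^-11, against about 1.23 * 10^-11 on the right;
    this is the origin of 19.\<close>
  hence L: "(\<Sum>j<4. \<bar>component s j\<bar>) * (1 / 10 ^ 6 * (4 / 10 ^ 6)) \<le> 8 * (9 / 10)\<^sup>2 * (19 / 10 ^ 13)"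
    by (rule order_trans) (simp add: power2_eq_square)
  have init: "mix_U 0 s n - vertex_U 0 n = (\<Sum>j<4. component s j * (vertex_U (Suc j) n - vertex_U 0 n))"
    "mix_V 0 s n - vertex_V 0 n = (\<Sum>j<4. component s j * (vertex_V (Suc j) n - vertex_V 0 n))" if "n \<le> 1" for n
  proof -
    have "n = 0 \<or> n = Suc 0" using that by auto
    thus "mix_U 0 s n - vertex_U 0 n = (\<Sum>j<4. component s j * (vertex_U (Suc j) n - vertex_U 0 n))"
      "mix_V 0 s n - vertex_V 0 n = (\<Sum>j<4. component s j * (vertex_V (Suc j) n - vertex_V 0 n))"
      by (auto simp: mix_diff)
  qed
  show ?thesis
    by (rule conjunct2[OF second_order_bound[where U = "\<lambda>n. mix_U 0 s n" and V = "\<lambda>n. mix_V 0 s n"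
          and U0 = "\<lambda>n. vertex_U 0 n" and V0 = "\<lambda>n. vertex_V 0 n"
          and Uj = "\<lambda>j n. vertex_U (Suc j) n" and Vj = "\<lambda>j n. vertex_V (Suc j) n",
          OF _ _ power_solution_coef power_solution_coef power_solution_coef _ _ _ _ _ _ L init]])
      (use assms in \<open>auto intro: mix_coef_bound vertex_coef_bound vertex_difference[simplified] mix_vertex_difference[simplified]\<close>)
qed

lemma verified_vertex: "e \<le> 4 \<Longrightarrow> verified (vertex_a e) (vertex_b e) (vertex_value e) (vertex_slope e)"
  using verified_vertex_0 verified_vertex_1 verified_vertex_2 verified_vertex_3 verified_vertex_4
  by (cases "e = 0"; cases "e = 1"; cases "e = 2"; cases "e = 3"; cases "e = 4") auto

text \<open>Vertex 0 contributes t and each difference 2 t, with weights of total at most 3: t + 3 *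
  2 t = 7 t.\<close>

lemma affine_error:
  fixes g T :: "nat \<Rightarrow> complex"
  assumes "norm (fst s) \<le> 1" "norm (snd s) \<le> 1" "\<And>e. e \<le> 4 \<Longrightarrow> norm (g e - T e) \<le> t" "T 0 = 0"
  shows "norm (g 0 + (\<Sum>j<4. of_real (component s j) * (g (Suc j) - g 0)) - (\<Sum>j<4. of_real (component s j) * T (Suc j))) \<le> 7 * t"
proof -
  have t: "0 \<le> t" using order_trans[OF norm_ge_zero assms(3)[of 0]] by simp
  have g0: "norm (g 0) \<le> t" using assms(3)[of 0] assms(4) by simp
  have "g 0 + (\<Sum>j<4. of_real (component s j) * (g (Suc j) - g 0)) - (\<Sum>j<4. of_real (component s j) * T (Suc j))
      = g 0 + (\<Sum>j<4. of_real (component s j) * (g (Suc j) - T (Suc j) - g 0))"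
    by (simp add: algebra_simps flip: sum_subtractf sum.distrib)
  also have "norm \<dots> \<le> norm (g 0) + norm (\<Sum>j<4. of_real (component s j) * (g (Suc j) - T (Suc j) - g 0))"
    by (rule norm_triangle_ineq)
  also have "norm (\<Sum>j<4. of_real (component s j) * (g (Suc j) - T (Suc j) - g 0)) \<le> (\<Sum>j<4. \<bar>component s j\<bar> * (2 * t))"
  proof (rule sum_norm_le)
    fix j :: nat assume "j \<in> {..<4}"
    hence "norm (g (Suc j) - T (Suc j) - g 0) \<le> 2 * t"
      using norm_triangle_ineq4[of "g (Suc j) - T (Suc j)" "g 0"] assms(3)[of "Suc j"] g0 by simp
    thus "norm (of_real (component s j) * (g (Suc j) - T (Suc j) - g 0)) \<le> \<bar>component s j\<bar> * (2 * t)"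
      unfolding norm_mult norm_of_real by (intro mult_left_mono) auto
  qed
  also have "(\<Sum>j<4. \<bar>component s j\<bar> * (2 * t)) = (\<Sum>j<4. \<bar>component s j\<bar>) * (2 * t)"
    by (simp add: sum_distrib_right)
  also have "\<dots> \<le> 3 * (2 * t)" using t by (intro mult_right_mono sum_abs_component_le assms) auto
  finally show ?thesis using g0 by simp
qed

text \<open>The error is bounded by the very factor h = 15/10^7 of the linear part, which is what
  makes the discs invariant under the map used for Brouwer's theorem.\<close>

lemma mix_estimates:
  assumes \<eta>: "0 \<le> \<eta>" "\<eta> \<le> 1 / 10 ^ 14" and s: "norm (fst s) \<le> 1" "norm (snd s) \<le> 1"
  shows "norm (power_sum (\<lambda>n. mix_V \<eta> s n) \<i> - 15 / 10 ^ 7 * fst s) \<le> 15 / 10 ^ 7"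
    and "norm (power_sum (\<lambda>n. real n * mix_V \<eta> s n) \<i> - 15 / 10 ^ 7 * snd s) \<le> 15 / 10 ^ 7"
proof -
  let ?A = "\<lambda>n. vertex_V 0 n + (\<Sum>j<4. component s j * (vertex_V (Suc j) n - vertex_V 0 n))"
  let ?T = "\<lambda>f e. Complex (of_int (fst (f e))) (of_int (snd (f e))) / 10 ^ 13"
  have err: "\<bar>mix_V \<eta> s n - ?A n\<bar> \<le> 20 / 10 ^ 13 * negbin (9 / 10) 4 n" for n
  proof -
    have "\<bar>mix_V \<eta> s n - mix_V 0 s n\<bar> \<le> 3 * \<eta> * negbin (9 / 10) 4 n"
      using \<eta> s by (intro parameter_bound[OF power_solution_coef power_solution_coef]) (auto intro!: mix_coef_bound)
    also have "\<dots> \<le> 1 / 10 ^ 13 * negbin (9 / 10) 4 n"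
      using \<eta> by (intro mult_right_mono negbin_nonneg) auto
    finally have "\<bar>mix_V \<eta> s n - ?A n\<bar> \<le> 1 / 10 ^ 13 * negbin (9 / 10) 4 n + 19 / 10 ^ 13 * negbin (9 / 10) 4 n"
      using mix_second_order[OF s, of n] by linarith
    thus ?thesis by simp
  qed
  have sv: "summable (\<lambda>n. of_real (vertex_V e n) * \<i> ^ n)" "summable (\<lambda>n. of_real (real n * vertex_V e n) * \<i> ^ n)"
    if "e \<le> 4" for e
    using summable_at_ii[OF vertex_coef_bound(2)[OF that]] by auto
  have sm: "summable (\<lambda>n. of_real (mix_V \<eta> s n) * \<i> ^ n)" "summable (\<lambda>n. of_real (real n * mix_V \<eta> s n) * \<i> ^ n)"
    using summable_at_ii[OF mix_coef_bound(2)[OF \<eta> s]] by auto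
  have a1: "(\<lambda>n. of_real (?A n) * \<i> ^ n) sums (power_sum (\<lambda>n. vertex_V 0 n) \<i>
      + (\<Sum>j<4. of_real (component s j) * (power_sum (\<lambda>n. vertex_V (Suc j) n) \<i> - power_sum (\<lambda>n. vertex_V 0 n) \<i>)))"
    by (rule power_sum_affine) (use sv in auto)
  have nA: "real n * ?A n = real n * vertex_V 0 n
      + (\<Sum>j<4. component s j * (real n * vertex_V (Suc j) n - real n * vertex_V 0 n))" for n
    by (simp add: algebra_simps sum_distrib_left)
  have a2: "(\<lambda>n. of_real (real n * ?A n) * \<i> ^ n) sums (power_sum (\<lambda>n. real n * vertex_V 0 n) \<i>
      + (\<Sum>j<4. of_real (component s j) * (power_sum (\<lambda>n. real n * vertex_V (Suc j) n) \<i> - power_sum (\<lambda>n. real n * vertex_V 0 n) \<i>)))"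
    unfolding nA by (rule power_sum_affine) (use sv in auto)
  note E = at_ii_error[OF sm(1) sums_summable[OF a1] sm(2) sums_summable[OF a2] err]
  have v: "norm (power_sum (\<lambda>n. vertex_V e n) \<i> - ?T vertex_value e) \<le> 1 / 10 ^ 7"
    "norm (power_sum (\<lambda>n. real n * vertex_V e n) \<i> - ?T vertex_slope e) \<le> 1 / 10 ^ 7" if "e \<le> 4" for e
    using verified_sound[OF verified_vertex[OF that] power_solution_coef] vertex_coef_bound[OF that]
    by (auto simp: scaled_def)
  have T: "(\<Sum>j<4. of_real (component s j) * ?T vertex_value (Suc j)) = 15 / 10 ^ 7 * fst s"
    "(\<Sum>j<4. of_real (component s j) * ?T vertex_slope (Suc j)) = 15 / 10 ^ 7 * snd s"
    by (simp_all add: sum_4 vertex_value_def vertex_slope_def complex_eq_iff)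
  have T0: "?T vertex_value 0 = 0" "?T vertex_slope 0 = 0"
    by (simp_all add: vertex_value_def vertex_slope_def complex_eq_iff)
  have A: "power_sum ?A \<i> = power_sum (\<lambda>n. vertex_V 0 n) \<i>
      + (\<Sum>j<4. of_real (component s j) * (power_sum (\<lambda>n. vertex_V (Suc j) n) \<i> - power_sum (\<lambda>n. vertex_V 0 n) \<i>))"
    "power_sum (\<lambda>n. real n * ?A n) \<i> = power_sum (\<lambda>n. real n * vertex_V 0 n) \<i>
      + (\<Sum>j<4. of_real (component s j) * (power_sum (\<lambda>n. real n * vertex_V (Suc j) n) \<i> - power_sum (\<lambda>n. real n * vertex_V 0 n) \<i>))"
    using a1 a2 by (simp_all only: power_sum_def sums_iff)
  \<comment> \<open>Error budget: nonlinearity and eta together cost 20/10^13 * 360000 = 7.2 * 10^-7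
    and the computed vertices 7 * 10^-7, in total less than h = 1.5 * 10^-6. The slope is the
    critical case, 360000 being the sum of n \<open>negbin (9 / 10) 4 n\<close>.\<close>
  have tri: "norm (x - z) \<le> 15 / 10 ^ 7" if "norm (x - y) \<le> 20 / 10 ^ 13 * 360000" "norm (y - z) \<le> 7 * (1 / 10 ^ 7)"
    for x y z :: complex
    using norm_triangle_ineq[of "x - y" "y - z"] that by simp
  show "norm (power_sum (\<lambda>n. mix_V \<eta> s n) \<i> - 15 / 10 ^ 7 * fst s) \<le> 15 / 10 ^ 7"
  proof (rule tri)
    show "norm (power_sum (\<lambda>n. mix_V \<eta> s n) \<i> - power_sum ?A \<i>) \<le> 20 / 10 ^ 13 * 360000"
      using E(1) by simp
    show "norm (power_sum ?A \<i> - 15 / 10 ^ 7 * fst s) \<le> 7 * (1 / 10 ^ 7)"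
      unfolding A(1) T(1)[symmetric]
      using affine_error[OF s, of "\<lambda>e. power_sum (\<lambda>n. vertex_V e n) \<i>" "?T vertex_value", OF v(1) T0(1)] .
  qed
  show "norm (power_sum (\<lambda>n. real n * mix_V \<eta> s n) \<i> - 15 / 10 ^ 7 * snd s) \<le> 15 / 10 ^ 7"
  proof (rule tri[OF E(2)])
    show "norm (power_sum (\<lambda>n. real n * ?A n) \<i> - 15 / 10 ^ 7 * snd s) \<le> 7 * (1 / 10 ^ 7)"
      unfolding A(2) T(2)[symmetric]
      using affine_error[OF s, of "\<lambda>e. power_sum (\<lambda>n. real n * vertex_V e n) \<i>" "?T vertex_slope", OF v(2) T0(2)] .
  qed
qed

section \<open>The fixed point and the lower bound\<close>

lemma continuous_on_mix: "continuous_on S (mix f)"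
  unfolding mix_def sum_4 component_simps One_nat_def by (intro continuous_intros)

text \<open>The coefficient bounds are uniform in s, so the series of continuous functions converges
  uniformly.\<close>

lemma continuous_on_mix_V:
  assumes "0 \<le> \<eta>" "\<eta> \<le> 1 / 10 ^ 14"
  shows "continuous_on (cball 0 1 \<times> cball 0 1) (\<lambda>s. power_sum (\<lambda>n. mix_V \<eta> s n) \<i>)"
    and "continuous_on (cball 0 1 \<times> cball 0 1) (\<lambda>s. power_sum (\<lambda>n. real n * mix_V \<eta> s n) \<i>)"
proof -
  let ?K = "cball 0 1 \<times> cball 0 1 :: (complex \<times> complex) set"
  have K: "norm (fst s) \<le> 1" "norm (snd s) \<le> 1" if "s \<in> ?K" for s using that by auto
  have c: "continuous_on ?K (\<lambda>s. mix_V \<eta> s n)" for n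
    by (intro continuous_on_snd continuous_on_coef continuous_on_mix)
  have "uniform_limit ?K (\<lambda>n s. \<Sum>i<n. of_real (mix_V \<eta> s i) * \<i> ^ i) (\<lambda>s. power_sum (\<lambda>n. mix_V \<eta> s n) \<i>) sequentially"
    unfolding power_sum_def
    by (rule Weierstrass_m_test[OF _ summable_mult[OF sums_summable[OF sums_negbin[of "9 / 10" 2]], of "6 * (9 / 10)\<^sup>2"]])
      (use mix_coef_bound(2)[OF assms K] in \<open>auto simp: norm_mult norm_power\<close>)
  thus "continuous_on ?K (\<lambda>s. power_sum (\<lambda>n. mix_V \<eta> s n) \<i>)"
    by (rule uniform_limit_theorem[rotated]) (auto intro!: always_eventually continuous_intros c)
  have "norm (of_real (real n * mix_V \<eta> s n) * \<i> ^ n) \<le> 6 * (9 / 10)\<^sup>2 * (real n * negbin (9 / 10) 2 n)" if "s \<in> ?K" for n s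
    using mult_left_mono[OF mix_coef_bound(2)[OF assms K[OF that]], of "real n" n]
    by (simp add: norm_mult norm_power mult_ac)
  hence "uniform_limit ?K (\<lambda>n s. \<Sum>i<n. of_real (real i * mix_V \<eta> s i) * \<i> ^ i)
      (\<lambda>s. power_sum (\<lambda>n. real n * mix_V \<eta> s n) \<i>) sequentially"
    unfolding power_sum_def
    by (rule Weierstrass_m_test[OF _ summable_mult[OF sums_summable[OF sums_nat_negbin[of "9 / 10" 2]]]]) auto
  thus "continuous_on ?K (\<lambda>s. power_sum (\<lambda>n. real n * mix_V \<eta> s n) \<i>)"
    by (rule uniform_limit_theorem[rotated]) (auto intro!: always_eventually continuous_intros c)
qed

lemma power_sum_times_n:
  assumes "summable (\<lambda>n. of_real (real n * c n) * z ^ n)"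
  shows "power_sum (\<lambda>n. real n * c n) z = z * power_sum (\<lambda>n. (real n + 1) * c (n + 1)) z"
proof -
  have s: "summable (\<lambda>n. of_real ((real n + 1) * c (n + 1)) * z ^ n)" if "z \<noteq> 0"
  proof -
    have "summable (\<lambda>n. inverse z * (of_real (real (Suc n) * c (Suc n)) * z ^ Suc n))"
      by (intro summable_mult assms[THEN summable_Suc_iff[THEN iffD2]])
    moreover have "inverse z * (of_real (real (Suc n) * c (Suc n)) * z ^ Suc n) = of_real ((real n + 1) * c (n + 1)) * z ^ n" for n
      using that by (simp add: field_simps)
    ultimately show ?thesis by (simp only:)
  qed
  show ?thesis
  proof (cases "z = 0")
    case False
    have "power_sum (\<lambda>n. real n * c n) z = (\<Sum>n. of_real (real (Suc n) * c (Suc n)) * z ^ Suc n)"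
      unfolding power_sum_def using suminf_split_head[OF assms] by simp
    also have "\<dots> = (\<Sum>n. z * (of_real ((real n + 1) * c (n + 1)) * z ^ n))"
      by (simp add: mult_ac add_ac)
    finally show ?thesis unfolding power_sum_def using suminf_mult[OF s[OF False]] by simp
  qed (simp add: power_sum_def power_0_left, subst suminf_finite[of "{0}"], auto)
qed

lemma clamped_power_solution_exists:
  assumes \<eta>: "0 \<le> \<eta>" "\<eta> \<le> 1 / 10 ^ 14"
  obtains U V where "power_solution \<eta> U V" "power_sum V \<i> = 0"
    "power_sum (\<lambda>n. (real n + 1) * V (n + 1)) \<i> = 0" "U 0 \<ge> 4"
    "\<And>n. \<bar>U n\<bar> \<le> 6 * (9 / 10)\<^sup>2 * negbin (9 / 10) 2 n" "\<And>n. \<bar>V n\<bar> \<le> 6 * (9 / 10)\<^sup>2 * negbin (9 / 10) 2 n"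
proof -
  let ?K = "cball 0 1 \<times> cball 0 1 :: (complex \<times> complex) set"
  \<comment> \<open>This is s - Phi(s)/h for the boundary map Phi: a fixed point is a zero of Phi,
    and \<open>mix_estimates\<close> states that the product of discs is mapped into itself.\<close>
  let ?F = "\<lambda>s. (fst s - power_sum (\<lambda>n. mix_V \<eta> s n) \<i> / (15 / 10 ^ 7),
      snd s - power_sum (\<lambda>n. real n * mix_V \<eta> s n) \<i> / (15 / 10 ^ 7))"
  have K: "norm (fst s) \<le> 1" "norm (snd s) \<le> 1" if "s \<in> ?K" for s using that by auto
  have div: "norm (x - y / (15 / 10 ^ 7)) \<le> 1" if "norm (y - 15 / 10 ^ 7 * x) \<le> 15 / 10 ^ 7" for x y :: complex
  proof -
    have "x - y / (15 / 10 ^ 7) = - ((y - 15 / 10 ^ 7 * x) / (15 / 10 ^ 7))" by (simp add: field_simps)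
    thus ?thesis using that by (simp only: norm_minus_cancel norm_divide) simp
  qed
  have "?F \<in> ?K \<rightarrow> ?K"
  proof (rule Pi_I)
    fix s assume "s \<in> ?K"
    from div[OF mix_estimates(1)[OF \<eta> K[OF this]]] div[OF mix_estimates(2)[OF \<eta> K[OF this]]]
    show "?F s \<in> ?K" unfolding mem_Times_iff mem_cball_0 fst_conv snd_conv ..
  qed
  moreover have "continuous_on ?K ?F"
    by (intro continuous_intros continuous_on_mix_V \<eta>) auto
  ultimately obtain s where s: "s \<in> ?K" "?F s = s"
    using brouwer[of ?K ?F] by (auto simp: compact_Times convex_Times)
  have z: "power_sum (\<lambda>n. mix_V \<eta> s n) \<i> = 0" "power_sum (\<lambda>n. real n * mix_V \<eta> s n) \<i> = 0"
    using s(2) by (auto simp: prod_eq_iff)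
  show thesis
  proof (rule that)
    show "power_solution \<eta> (\<lambda>n. mix_U \<eta> s n) (\<lambda>n. mix_V \<eta> s n)" by (rule power_solution_coef)
    show "power_sum (\<lambda>n. (real n + 1) * mix_V \<eta> s (n + 1)) \<i> = 0"
      using power_sum_times_n[OF summable_at_ii(2)[OF mix_coef_bound(2)[OF \<eta> K[OF s(1)]]]] z(2) by simp
    show "4 \<le> mix_U \<eta> s 0"
      using mix_bounds(1)[OF K[OF s(1)]] unfolding center_values abs_le_iff by simp
  qed (use z mix_coef_bound[OF \<eta> K[OF s(1)]] in auto)
qed

text \<open>For n >= 1 one has |z|^n <= |z|, so the sum deviates from its constant term by at most
  |z| times the majorant at 1.\<close>

lemma norm_power_sum_ge:
  assumes "\<And>n. \<bar>c n\<bar> \<le> M * negbin r p n" "0 \<le> r" "r < 1" "norm z \<le> 1"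
  shows "\<bar>c 0\<bar> - M * (1 - r) powr - p * norm z \<le> norm (power_sum c z)"
proof -
  have rz: "r * norm z < 1"
    using mult_left_mono[OF assms(4,2)] assms(3) by simp
  have "(\<lambda>n. if n = 0 then of_real (c 0) else 0) sums (of_real (c 0) :: complex)"
    using sums_single[of 0 "\<lambda>_. of_real (c 0) :: complex"] by simp
  from sums_diff[OF power_sum_sums[OF assms(1,2) rz] this]
  have "norm (power_sum c z - of_real (c 0)) \<le> M * (1 - r) powr - p * norm z"
  proof (rule norm_sums_le)
    show "(\<lambda>n. M * negbin r p n * norm z) sums (M * (1 - r) powr - p * norm z)"
      by (intro sums_mult2 sums_mult sums_negbin assms)
    fix n
    have M: "0 \<le> M * negbin r p n" using order_trans[OF abs_ge_zero assms(1)] .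
    show "norm (of_real (c n) * z ^ n - (if n = 0 then of_real (c 0) else 0)) \<le> M * negbin r p n * norm z"
    proof (cases n)
      case (Suc m)
      have "norm z ^ n \<le> norm z" using assms(4) Suc power_le_one[of "norm z" m] by (simp add: mult_left_le)
      hence "\<bar>c n\<bar> * norm z ^ n \<le> (M * negbin r p n) * norm z"
        by (intro mult_mono assms(1) M) auto
      thus ?thesis by (simp add: Suc norm_mult norm_power)
    qed (use M in simp)
  qed
  thus ?thesis
    using norm_triangle_ineq2[of "of_real (c 0)" "of_real (c 0) - power_sum c z"]
    by (simp add: norm_minus_commute)
qed

theorem theorem1p1:
  fixes q \<chi>\<^sub>1 \<chi>\<^sub>2 :: real
  assumes "q > 0" and "\<chi>\<^sub>1 > 0" and "\<chi>\<^sub>2 > 0"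
  shows "\<exists>\<delta>>0. \<exists>c>0. \<forall>\<omega>\<in>{0<..<\<delta>}.
           eigenvalue q \<chi>\<^sub>1 \<chi>\<^sub>2 \<omega> \<and>
           (\<exists>E\<^sub>1 E\<^sub>2. eigenfunction q \<chi>\<^sub>1 \<chi>\<^sub>2 \<omega> E\<^sub>1 E\<^sub>2 \<and>
              E\<^sub>1 \<in> H2_space {0<..<1} \<and> E\<^sub>2 \<in> L2_space {0<..<1} \<and>
              H2_L2_norm_on {0<..<1} E\<^sub>1 E\<^sub>2 \<ge> c / \<omega>\<^sup>2)"
proof -
  \<comment> \<open>Chosen so that eta = omega^2 q / 4 is at most 10^-14.\<close>
  define \<delta> where "\<delta> = 2 / 10 ^ 7 / sqrt q"
  \<comment> \<open>The scaling factor a without 1/omega^2, times the root of the length 1/200 of an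
    interval around 1/2 on which |u| is at least 1.\<close>
  define c where "c = 4 / sqrt (\<chi>\<^sub>1 * \<chi>\<^sub>2) * sqrt (1 / 200)"
  have main: "\<exists>E\<^sub>1 E\<^sub>2. eigenfunction q \<chi>\<^sub>1 \<chi>\<^sub>2 \<omega> E\<^sub>1 E\<^sub>2 \<and>
      E\<^sub>1 \<in> H2_space {0<..<1} \<and> E\<^sub>2 \<in> L2_space {0<..<1} \<and> H2_L2_norm_on {0<..<1} E\<^sub>1 E\<^sub>2 \<ge> c / \<omega>\<^sup>2"
    if \<omega>: "0 < \<omega>" "\<omega> < \<delta>" for \<omega>
  proof -
    have "\<omega>\<^sup>2 \<le> \<delta>\<^sup>2" using \<omega> by (intro power_mono) auto
    hence "\<omega>\<^sup>2 * q \<le> \<delta>\<^sup>2 * q" using assms(1) by (intro mult_right_mono) auto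
    also have "\<delta>\<^sup>2 * q = 4 / 10 ^ 14" using assms(1) by (simp add: \<delta>_def power_divide)
    finally have "\<omega>\<^sup>2 * q / 4 \<le> 4 / 10 ^ 14 / 4" by (rule divide_right_mono) simp
    hence \<eta>: "0 \<le> \<omega>\<^sup>2 * q / 4" "\<omega>\<^sup>2 * q / 4 \<le> 1 / 10 ^ 14" using assms(1) by simp_all
    obtain U V where sol: "power_solution (\<omega>\<^sup>2 * q / 4) U V"
        and bc: "power_sum V \<i> = 0" "power_sum (\<lambda>n. (real n + 1) * V (n + 1)) \<i> = 0" and U0: "U 0 \<ge> 4"
        and bd: "\<And>n. \<bar>U n\<bar> \<le> 6 * (9 / 10)\<^sup>2 * negbin (9 / 10) 2 n" "\<And>n. \<bar>V n\<bar> \<le> 6 * (9 / 10)\<^sup>2 * negbin (9 / 10) 2 n"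
      using clamped_power_solution_exists[OF \<eta>] by blast
    let ?E1 = "\<lambda>x. of_real (4 / (\<omega>\<^sup>2 * sqrt (\<chi>\<^sub>1 * \<chi>\<^sub>2))) * power_sum U (segment x)"
    let ?E2 = "\<lambda>x. of_real (4 / (\<omega>\<^sup>2 * \<chi>\<^sub>1)) * power_sum V (segment x)"
    have U0': "U 0 \<noteq> 0" using U0 by simp
    have E: "eigenfunction q \<chi>\<^sub>1 \<chi>\<^sub>2 \<omega> ?E1 ?E2" "?E1 \<in> H2_space {0<..<1}" "?E2 \<in> L2_space {0<..<1}"
      by (rule eigenfunction_of_power_solution[OF assms(2,3) \<omega>(1) _ _ sol bd bc U0']; simp)+
    have "4 / (\<omega>\<^sup>2 * sqrt (\<chi>\<^sub>1 * \<chi>\<^sub>2)) * sqrt ((1 / 2 + 1 / 400) - (1 / 2 - 1 / 400)) \<le> L2_norm_on {0<..<1} ?E1"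
    proof (rule L2_norm_ge)
      show "?E1 \<in> L2_space {0<..<1}" using E(2) by (simp add: H2_space_def)
      fix x :: real assume "x \<in> {1 / 2 - 1 / 400..1 / 2 + 1 / 400}"
      hence z: "norm (segment x) \<le> 1 / 200" unfolding norm_segment abs_le_iff by simp
      \<comment> \<open>W(1) = 4.86 * 100 = 486, so for |z| <= 1/200 the sum differs from
        \<open>U 0\<close> by at most 2.43, while \<open>U 0\<close> is at least 4.\<close>
      have "1 \<le> norm (power_sum U (segment x))"
        using norm_power_sum_ge[OF bd(1), of "segment x"] z U0
        by (simp add: powr_minus powr_numeral power_divide power2_eq_square)
      hence "4 / (\<omega>\<^sup>2 * sqrt (\<chi>\<^sub>1 * \<chi>\<^sub>2)) * 1 \<le> 4 / (\<omega>\<^sup>2 * sqrt (\<chi>\<^sub>1 * \<chi>\<^sub>2)) * norm (power_sum U (segment x))"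
        using assms by (intro mult_left_mono) auto
      thus "4 / (\<omega>\<^sup>2 * sqrt (\<chi>\<^sub>1 * \<chi>\<^sub>2)) \<le> norm (?E1 x)"
        using assms unfolding norm_mult norm_of_real by simp
    qed (use assms in auto)
    also have "\<dots> \<le> H2_L2_norm_on {0<..<1} ?E1 ?E2" by (rule L2_norm_le_H2_L2_norm)
    also have "4 / (\<omega>\<^sup>2 * sqrt (\<chi>\<^sub>1 * \<chi>\<^sub>2)) * sqrt ((1 / 2 + 1 / 400) - (1 / 2 - 1 / 400)) = c / \<omega>\<^sup>2"
      by (simp add: c_def)
    finally show ?thesis using E by blast
  qed
  have "\<delta> > 0" "c > 0" using assms by (simp_all add: \<delta>_def c_def)
  moreover have "\<forall>\<omega>\<in>{0<..<\<delta>}. eigenvalue q \<chi>\<^sub>1 \<chi>\<^sub>2 \<omega> \<and>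
      (\<exists>E\<^sub>1 E\<^sub>2. eigenfunction q \<chi>\<^sub>1 \<chi>\<^sub>2 \<omega> E\<^sub>1 E\<^sub>2 \<and>
        E\<^sub>1 \<in> H2_space {0<..<1} \<and> E\<^sub>2 \<in> L2_space {0<..<1} \<and> H2_L2_norm_on {0<..<1} E\<^sub>1 E\<^sub>2 \<ge> c / \<omega>\<^sup>2)"
    using main unfolding eigenvalue_def by fastforce
  ultimately show ?thesis by blast
qed

end
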